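(* Let $\mathbb{K}$ be an algebraically closed field, let $q\in\mathbb{K}^*$ be such that $q^2$ is a primitive $l$-th root of unity with $l>1$, and let $\alpha\in\mathbb{K}^*$. Put $g:=xy-yx\in A(\alpha,0,0)$. Then each simple $A(\alpha,0,0)$-module on which $z$ acts nilpotently and $g$ acts invertibly is isomorphic to one of the following simple $A(\alpha,0,0)$-modules: (i) $M_6(\mu_1,\mu_2)$ for some $(\mu_1,\mu_2)\in(\mathbb{K}^* )^2$; (ii) $M_7(\mu)$ for some $\mu\in\mathbb{K}$.
   Context: For $\alpha\in\mathbb{K}$ and $q\in\mathbb{K}^*$, $A(\alpha,0,0)$ is the associative unital $\mathbb{K}$-algebra generated by $x,y,z$ subject to $xy=q^2yx+\alpha$, $xz=q^{-2}zx$, $yz=q^2zy$. Modules are right modules (so in $m\,xy$ the element $x$ acts first). $M_6(\mu_1,\mu_2)$, for $(\mu_1,\mu_2)\in(\mathbb{K}^* )^2$: the $\mathbb{K}$-vector space with basis $m_k$, $0\le k\le l-1$, with $$m_kx=\mu_1m_{k+1}\ (k\neq l-1),\qquad m_{l-1}x=\mu_1m_0,$$ $$m_ky=\mu_1^{-1}\tfrac{q^{2k}\mu_2-\alpha}{q^2-1}m_{k-1}\ (k\neq0),\qquad m_0y=\mu_1^{-1}\tfrac{\mu_2-\alpha}{q^2-1}m_{l-1},\qquad m_kz=0.$$ $M_7(\mu)$, for $\mu\in\mathbb{K}$: the $\mathbb{K}$-vector space with basis $m_k$, $0\le k\le l-1$, with $$m_kx=-q^{-2}\alpha\tfrac{1-q^{-2k}}{1-q^{-2}}m_{k-1}\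 (k\neq0),\qquad m_0x=0,$$ $$m_ky=m_{k+1}\ (k\neq l-1),\qquad m_{l-1}y=\mu m_0,\qquad m_kz=0.$$ *)

theory Defs
  imports "HOL-Library.Poly_Mapping" "HOL-Algebra.QuotRing" "HOL-Algebra.Module"
    "HOL-Algebra.Algebraic_Closure_Type"
begin

datatype gen = GX | GY | GZ

text \<open>The free monoid on the generators, written additively because the convolution product
  of \<^theory>\<open>HOL-Library.Poly_Mapping\<close> multiplies monomials by adding their exponents.\<close>

datatype word = Word (letters: "gen list")

instantiation word :: monoid_add
begin

definition zero_word :: word where "zero_word = Word []"

definition plus_word :: "word \<Rightarrow> word \<Rightarrow> word" where
  "plus_word u v = Word (letters u @ letters v)"

instance
  by standard (simp_all add: zero_word_def plus_word_def)

end

type_synonym 'k free_alg = "word \<Rightarrow>\<^sub>0 'k"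

definition fgen :: "gen \<Rightarrow> 'k::field free_alg" where
  "fgen g = Poly_Mapping.single (Word [g]) 1"

definition fconst :: "'k \<Rightarrow> 'k::field free_alg" where
  "fconst c = Poly_Mapping.single 0 c"

abbreviation free_ring :: "'k::field free_alg ring" where
  "free_ring \<equiv> ring_of_type_algebra"

definition A_relators :: "'k::field \<Rightarrow> 'k \<Rightarrow> 'k free_alg set" where
  "A_relators q \<alpha> =
    {fgen GX * fgen GY - (fconst (q^2) * fgen GY * fgen GX + fconst \<alpha>),
     fgen GX * fgen GZ - fconst (inverse (q^2)) * fgen GZ * fgen GX,
     fgen GY * fgen GZ - fconst (q^2) * fgen GZ * fgen GY}"

definition A_ideal :: "'k::field \<Rightarrow> 'k \<Rightarrow> 'k free_alg set" where
  "A_ideal q \<alpha> = Idl\<^bsub>free_ring\<^esub> (A_relators q \<alpha>)"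

definition A_alg :: "'k::field \<Rightarrow> 'k \<Rightarrow> 'k free_alg set ring" where
  "A_alg q \<alpha> = free_ring Quot A_ideal q \<alpha>"

definition A_gen :: "'k::field \<Rightarrow> 'k \<Rightarrow> gen \<Rightarrow> 'k free_alg set" where
  "A_gen q \<alpha> g = A_ideal q \<alpha> +>\<^bsub>free_ring\<^esub> fgen g"

definition A_g :: "'k::field \<Rightarrow> 'k \<Rightarrow> 'k free_alg set" where
  "A_g q \<alpha> =
    (A_gen q \<alpha> GX \<otimes>\<^bsub>A_alg q \<alpha>\<^esub> A_gen q \<alpha> GY) \<ominus>\<^bsub>A_alg q \<alpha>\<^esub>
    (A_gen q \<alpha> GY \<otimes>\<^bsub>A_alg q \<alpha>\<^esub> A_gen q \<alpha> GX)"

text \<open>Right modules share the record type of the library's (left) modules over commutative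
  rings: \<open>a \<odot>\<^bsub>M\<^esub> m\<close> stands for the right action $m\,a$, so that in $m\,(ab)$
  the element $a$ acts first. A right module over a $\mathbb{K}$-algebra is one over the
  underlying ring; the scalars act through the images of the constants, and module
  homomorphisms are automatically $\mathbb{K}$-linear.\<close>

locale right_module = R?: ring R + M?: abelian_group M
  for R :: "('a, 'c) ring_scheme" (structure) and M :: "('a, 'm, 'd) module_scheme" (structure) +
  assumes act_closed:
      "\<lbrakk>a \<in> carrier R; m \<in> carrier M\<rbrakk> \<Longrightarrow> a \<odot>\<^bsub>M\<^esub> m \<in> carrier M"
    and act_distrib_ring:
      "\<lbrakk>a \<in> carrier R; b \<in> carrier R; m \<in> carrier M\<rbrakk> \<Longrightarrow>
        (a \<oplus>\<^bsub>R\<^esub> b) \<odot>\<^bsub>M\<^esub> m = (a \<odot>\<^bsub>M\<^esub> m) \<oplus>\<^bsub>M\<^esub> (b \<odot>\<^bsub>M\<^esub> m)"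
    and act_distrib_module:
      "\<lbrakk>a \<in> carrier R; m \<in> carrier M; n \<in> carrier M\<rbrakk> \<Longrightarrow>
        a \<odot>\<^bsub>M\<^esub> (m \<oplus>\<^bsub>M\<^esub> n) = (a \<odot>\<^bsub>M\<^esub> m) \<oplus>\<^bsub>M\<^esub> (a \<odot>\<^bsub>M\<^esub> n)"
    and act_mult:
      "\<lbrakk>a \<in> carrier R; b \<in> carrier R; m \<in> carrier M\<rbrakk> \<Longrightarrow>
        (a \<otimes>\<^bsub>R\<^esub> b) \<odot>\<^bsub>M\<^esub> m = b \<odot>\<^bsub>M\<^esub> (a \<odot>\<^bsub>M\<^esub> m)"
    and act_one:
      "m \<in> carrier M \<Longrightarrow> \<one>\<^bsub>R\<^esub> \<odot>\<^bsub>M\<^esub> m = m"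

text \<open>The library's locale \<open>submodule\<close> only asks for an additive subgroup that is stable
  under the action, so it applies to right modules as it stands.\<close>

definition simple_right_module ::
    "('a, 'c) ring_scheme \<Rightarrow> ('a, 'm, 'd) module_scheme \<Rightarrow> bool" where
  "simple_right_module R M \<longleftrightarrow>
    right_module R M \<and> carrier M \<noteq> {\<zero>\<^bsub>M\<^esub>} \<and>
    (\<forall>N. submodule N R M \<longrightarrow> N = {\<zero>\<^bsub>M\<^esub>} \<or> N = carrier M)"

definition right_module_iso ::
    "('a, 'c) ring_scheme \<Rightarrow> ('a, 'm, 'd) module_scheme \<Rightarrow> ('a, 'n, 'e) module_scheme \<Rightarrow> bool" where
  "right_module_iso R M N \<longleftrightarrow>
    (\<exists>\<phi>. bij_betw \<phi> (carrier M) (carrier N) \<and>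
      (\<forall>m\<in>carrier M. \<forall>n\<in>carrier M. \<phi> (m \<oplus>\<^bsub>M\<^esub> n) = \<phi> m \<oplus>\<^bsub>N\<^esub> \<phi> n) \<and>
      (\<forall>a\<in>carrier R. \<forall>m\<in>carrier M. \<phi> (a \<odot>\<^bsub>M\<^esub> m) = a \<odot>\<^bsub>N\<^esub> \<phi> m))"

definition acts_nilpotently :: "('a, 'm, 'd) module_scheme \<Rightarrow> 'a \<Rightarrow> bool" where
  "acts_nilpotently M a \<longleftrightarrow>
    (\<exists>n. \<forall>m\<in>carrier M. ((\<lambda>v. a \<odot>\<^bsub>M\<^esub> v) ^^ n) m = \<zero>\<^bsub>M\<^esub>)"

definition acts_invertibly :: "('a, 'm, 'd) module_scheme \<Rightarrow> 'a \<Rightarrow> bool" where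
  "acts_invertibly M a \<longleftrightarrow> bij_betw (\<lambda>v. a \<odot>\<^bsub>M\<^esub> v) (carrier M) (carrier M)"

text \<open>The vector space with basis $m_0,\dots,m_{l-1}$ consists of the coordinate functions
  that vanish from \<open>l\<close> on; \<open>bvec c k\<close> is $c\,m_k$.\<close>

definition bvec :: "'k::field \<Rightarrow> nat \<Rightarrow> nat \<Rightarrow> 'k" where
  "bvec c k = (\<lambda>i. if i = k then c else 0)"

definition lin_ext :: "nat \<Rightarrow> (nat \<Rightarrow> nat \<Rightarrow> 'k::field) \<Rightarrow> (nat \<Rightarrow> 'k) \<Rightarrow> nat \<Rightarrow> 'k" where
  "lin_ext l b v = (\<lambda>i. \<Sum>k<l. v k * b k i)"

text \<open>\<open>b g k\<close> is the vector $m_k\,g$. The action is a right action, so the letters of a word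
  act from left to right, which is what \<open>fold\<close> does.\<close>

definition free_act ::
    "nat \<Rightarrow> (gen \<Rightarrow> nat \<Rightarrow> nat \<Rightarrow> 'k::field) \<Rightarrow> 'k free_alg \<Rightarrow> (nat \<Rightarrow> 'k) \<Rightarrow> nat \<Rightarrow> 'k" where
  "free_act l b p v =
    (\<lambda>i. \<Sum>w\<in>Poly_Mapping.keys p.
      Poly_Mapping.lookup p w * fold (\<lambda>g. lin_ext l (b g)) (letters w) v i)"

text \<open>An element of $A(\alpha,0,0)$ is a coset of the ideal of relations; it acts through any of
  its representatives. The choice is immaterial as soon as the relators act by zero, as they do
  for the two families below.\<close>

definition basis_module ::
    "nat \<Rightarrow> (gen \<Rightarrow> nat \<Rightarrow> nat \<Rightarrow> 'k::field) \<Rightarrow> ('k free_alg set, nat \<Rightarrow> 'k) module" where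
  "basis_module l b =
    \<lparr>carrier = {v. \<forall>i\<ge>l. v i = 0},
     monoid.mult = undefined, one = undefined,
     ring.zero = (\<lambda>i. 0), add = (\<lambda>u v i. u i + v i),
     module.smult = (\<lambda>a. free_act l b (SOME p. p \<in> a))\<rparr>"

definition M6_basis_act ::
    "'k::field \<Rightarrow> 'k \<Rightarrow> nat \<Rightarrow> 'k \<Rightarrow> 'k \<Rightarrow> gen \<Rightarrow> nat \<Rightarrow> nat \<Rightarrow> 'k" where
  "M6_basis_act q \<alpha> l \<mu>\<^sub>1 \<mu>\<^sub>2 g k = (case g of
      GX \<Rightarrow> if k \<noteq> l - 1 then bvec \<mu>\<^sub>1 (k + 1) else bvec \<mu>\<^sub>1 0
    | GY \<Rightarrow> if k \<noteq> 0 then bvec (inverse \<mu>\<^sub>1 * ((q^(2*k) * \<mu>\<^sub>2 - \<alpha>) / (q^2 - 1))) (k - 1)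
           else bvec (inverse \<mu>\<^sub>1 * ((\<mu>\<^sub>2 - \<alpha>) / (q^2 - 1))) (l - 1)
    | GZ \<Rightarrow> (\<lambda>i. 0))"

definition M6 ::
    "'k::field \<Rightarrow> 'k \<Rightarrow> nat \<Rightarrow> 'k \<Rightarrow> 'k \<Rightarrow> ('k free_alg set, nat \<Rightarrow> 'k) module" where
  "M6 q \<alpha> l \<mu>\<^sub>1 \<mu>\<^sub>2 = basis_module l (M6_basis_act q \<alpha> l \<mu>\<^sub>1 \<mu>\<^sub>2)"

definition M7_basis_act ::
    "'k::field \<Rightarrow> 'k \<Rightarrow> nat \<Rightarrow> 'k \<Rightarrow> gen \<Rightarrow> nat \<Rightarrow> nat \<Rightarrow> 'k" where
  "M7_basis_act q \<alpha> l \<mu> g k = (case g of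
      GX \<Rightarrow> if k \<noteq> 0
           then bvec (- (inverse (q^2) * \<alpha> *
                  ((1 - inverse (q^(2*k))) / (1 - inverse (q^2))))) (k - 1)
           else (\<lambda>i. 0)
    | GY \<Rightarrow> if k \<noteq> l - 1 then bvec 1 (k + 1) else bvec \<mu> 0
    | GZ \<Rightarrow> (\<lambda>i. 0))"

definition M7 :: "'k::field \<Rightarrow> 'k \<Rightarrow> nat \<Rightarrow> 'k \<Rightarrow> ('k free_alg set, nat \<Rightarrow> 'k) module" where
  "M7 q \<alpha> l \<mu> = basis_module l (M7_basis_act q \<alpha> l \<mu>)"

definition is_primitive_root_of_unity :: "nat \<Rightarrow> 'k::field \<Rightarrow> bool" where
  "is_primitive_root_of_unity n \<zeta> \<longleftrightarrow>
    0 < n \<and> \<zeta> ^ n = 1 \<and> (\<forall>k. 0 < k \<and> k < n \<longrightarrow> \<zeta> ^ k \<noteq> 1)"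

end

theory Submission
  imports Defs
begin

text \<open>Pick a nonzero vector of the simple module $M$; its annihilator $J$ is a maximal right ideal of
  the free algebra $F$, and all of $M$ is recovered as $F/J$. Since $z$ is normal and nilpotent, it
  acts by zero by Schur's lemma. As $q^2$ is an $l$-th root of unity, $x^l$ and $y^l$ are central, and
  $F/J$ is spanned over $\mathbb{K}[x^l, y^l]$ by the finitely many $x^i y^j$ with $i, j < l$. A weak
  Nullstellensatz for two variables yields a scalar $a$ for which $x^l - a$ is not surjective, hence
  $x^l = a$ by Schur's lemma, and likewise $y^l = b$. If $a \neq 0$, an eigenvector of $g$, translated
  by the powers of $x$, spans a copy of $M_6$, with $\mu_1$ an $l$-th root of $a$; if $a = 0$, a vector
  killed by $x$, translated by the powers of $y$, spans a copy of $M_7(b)$. Both families are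
  simple because $g$ acts diagonally with distinct eigenvalues.\<close>

section \<open>Specialising an ideal of bivariate polynomials\<close>

text \<open>The module is not known to be finite-dimensional and the field may be countable, so it
  is not clear at the outset that central elements act by scalars, and no operator can be assumed to
  have an eigenvector. Finite generation over K[x^l, y^l] yields something weaker: some vector is
  missed by x^l - a. For a central operator on a simple module a proper image already forces the
  operator to be zero. Eigenvectors become accessible only once x^l and y^l are scalars. The element
  g is not central, but g^l is, and g^l - c^l factors through g - c, so a vector missed by g - c is
  also missed by g^l - c^l. Invertibility of g then keeps its eigenvalue, the future
  \<open>\<mu>\<^sub>2\<close>, away from 0.

  All computations take place in the free algebra F: vectors are elements modulo J, operators are
  elements modulo the largest two-sided ideal inside J. The final isomorphism rests on one inclusion
  of annihilators between simple modules, and linear independence of the translated vectors follows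
  from it.\<close>

lemma poly_map_poly_eval: "poly (map_poly (\<lambda>c. poly c a) f) b = poly (poly f [:b:]) a"
  for f :: "'k::comm_ring_1 poly poly"
  by (induction f) (auto simp: map_poly_pCons)

lemma alg_closed_nonroot:
  fixes c :: "'k::alg_closed_field poly"
  assumes "c \<noteq> 0"
  obtains a where "poly c a \<noteq> 0"
proof -
  \<comment> \<open>This is the polynomial X c - 1; at a root a one has a c(a) = 1.\<close>
  have "degree (pCons (-1) c) > 0" using assms by simp
  then obtain a where "poly (pCons (-1) c) a = 0" using alg_closed_imp_poly_has_root by blast
  then have "poly c a \<noteq> 0" by auto
  then show ?thesis by (rule that)
qed

text \<open>Read these as polynomials in y over K[x]: the inner variable is x, the outer one y. The
  value a is the first coordinate of a Nullstellensatz point, in the form that I and x - a together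
  still miss 1. If I contains a nonzero element of K[x], a root of one of least degree works;
  otherwise a only has to avoid the zeros of the leading coefficient of an element of least
  y-degree.\<close>

lemma bivariate_ideal_specialise:
  fixes I :: "'k::alg_closed_field poly poly set"
  assumes zero: "0 \<in> I"
    and add: "\<And>f g. f \<in> I \<Longrightarrow> g \<in> I \<Longrightarrow> f + g \<in> I"
    and mult: "\<And>f h. f \<in> I \<Longrightarrow> h * f \<in> I"
    and one: "1 \<notin> I"
  obtains a where "\<And>f u. f \<in> I \<Longrightarrow> f + [:[:-a, 1:]:] * u \<noteq> 1"
proof (cases "\<exists>h. h \<noteq> 0 \<and> [:h:] \<in> I")
  case True
  then obtain h where h: "h \<noteq> 0" "[:h:] \<in> I"
    and min: "\<And>h'. h' \<noteq> 0 \<Longrightarrow> [:h':] \<in> I \<Longrightarrow> degree h \<le> degree h'"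
    using ex_has_least_nat[of "\<lambda>h. h \<noteq> 0 \<and> [:h:] \<in> I" _ degree] by blast
  have "degree h \<noteq> 0"
  proof
    assume "degree h = 0"
    then obtain c where c: "h = [:c:]" by (rule degree_eq_zeroE)
    with h have "c \<noteq> 0" by auto
    then have "1 = [:[:inverse c:]:] * [:h:]" by (simp add: c one_pCons)
    then show False using mult[OF h(2)] one by metis
  qed
  then obtain a where "poly h a = 0" using alg_closed_imp_poly_has_root by blast
  then obtain h' where h': "h = [:-a, 1:] * h'" by (auto simp: poly_eq_0_iff_dvd)
  with h have nz: "h' \<noteq> 0" by auto
  have deg: "degree h = Suc (degree h')" unfolding h' using nz by (subst degree_mult_eq) auto
  show ?thesis
  proof (rule that[of a], rule notI)
    fix f u assume f: "f \<in> I" and eq: "f + [:[:-a, 1:]:] * u = 1"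
    \<comment> \<open>Multiplying the supposed relation by h' = h / (x - a) puts h' into I, against
      the minimal degree of h.\<close>
    have "[:h':] = [:h':] * (f + [:[:-a, 1:]:] * u)" unfolding eq by simp
    also have "\<dots> = [:h':] * f + u * [:h:]"
      by (simp add: h' algebra_simps)
    also have "\<dots> \<in> I" using add mult f h by blast
    finally show False using min[OF nz] deg by simp
  qed
next
  case False
  show ?thesis
  proof (cases "I = {0}")
    case True
    show ?thesis
    proof (rule that[of 0], rule notI)
      fix f u :: "'k poly poly" assume "f \<in> I" and eq: "f + [:[:-0, 1:]:] * u = 1"
      then have "f = 0" using True by simp
      have "poly (poly (f + [:[:-0, 1:]:] * u) 0) 0 = (0::'k)" by (simp add: \<open>f = 0\<close>)
      then show False unfolding eq by simp
    qed
  next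
    case nz: False
    then obtain f where f: "f \<noteq> 0" "f \<in> I"
      and min: "\<And>g. g \<noteq> 0 \<Longrightarrow> g \<in> I \<Longrightarrow> degree f \<le> degree g"
      using ex_has_least_nat[of "\<lambda>h. h \<noteq> 0 \<and> h \<in> I" _ degree] zero by blast
    have deg: "degree f > 0" using f False by (metis degree_eq_zeroE gr0I pCons_eq_0_iff)
    obtain a where a: "poly (lead_coeff f) a \<noteq> 0" using f alg_closed_nonroot by (metis leading_coeff_0_iff)
    \<comment> \<open>This is f(a, y). Its y-degree does not drop, since a is no root of the leading
      coefficient, so it has a root b.\<close>
    let ?fa = "map_poly (\<lambda>c. poly c a) f"
    have "coeff ?fa (degree f) \<noteq> 0" using a by (simp add: coeff_map_poly)
    then have "degree ?fa > 0" using deg le_degree by (metis bot_nat_0.not_eq_extremum leD)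
    then obtain b where "poly ?fa b = 0" using alg_closed_imp_poly_has_root by blast
    then have b: "poly (poly f [:b:]) a = 0" by (simp add: poly_map_poly_eval)
    show ?thesis
    proof (rule that[of a], rule notI)
      fix p u assume p: "p \<in> I" and eq: "p + [:[:-a, 1:]:] * u = 1"
      \<comment> \<open>By minimality of the y-degree of f the remainder vanishes, so a power of the
        leading coefficient times p is a multiple of f. At (a, b) both f and x - a vanish, and the
        relation would make that power 0 at a.\<close>
      obtain w r where wr: "pseudo_divmod p f = (w, r)" by (cases "pseudo_divmod p f")
      let ?c = "lead_coeff f ^ (Suc (degree p) - degree f)"
      have id: "smult ?c p = f * w + r" and r: "r = 0 \<or> degree r < degree f"
        using pseudo_divmod[OF f(1) wr] by auto
      have "r = [:?c:] * p + (- w) * f" using id by (simp add: algebra_simps)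
      then have "r \<in> I" using add mult p f by metis
      then have "r = 0" using r min by force
      have "?c = poly (smult ?c (p + [:[:-a, 1:]:] * u)) [:b:]" unfolding eq by simp
      also have "\<dots> = poly f [:b:] * poly w [:b:] + ?c * [:-a, 1:] * poly u [:b:]"
        using id \<open>r = 0\<close> by (simp add: smult_add_right algebra_simps flip: poly_mult)
      finally have "poly ?c a = poly (poly f [:b:] * poly w [:b:] + ?c * [:-a, 1:] * poly u [:b:]) a" by metis
      then have "poly ?c a = 0" using b by simp
      then show False using a by (simp add: poly_power)
    qed
  qed
qed

section \<open>Maximal right ideals of the free algebra\<close>

lemma fconst_0 [simp]: "fconst 0 = (0::'k::field free_alg)"
  and fconst_1 [simp]: "fconst 1 = (1::'k free_alg)"
  by (simp_all add: fconst_def)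

lemma fconst_add: "fconst (c + d) = fconst c + (fconst d :: 'k::field free_alg)"
  by (simp add: fconst_def single_add)

lemma fconst_mult: "fconst (c * d) = fconst c * (fconst d :: 'k::field free_alg)"
  by (simp add: fconst_def mult_single)

lemma fconst_minus: "fconst (- c) = - (fconst c :: 'k::field free_alg)"
  by (simp add: fconst_def single_uminus)

lemma fconst_diff: "fconst (c - d) = fconst c - (fconst d :: 'k::field free_alg)"
  by (simp add: fconst_def single_diff)

definition fword :: "gen list \<Rightarrow> 'k::field free_alg" where
  "fword ws = Poly_Mapping.single (Word ws) 1"

lemma fword_Nil [simp]: "fword [] = 1"
  by (simp add: fword_def flip: zero_word_def)

lemma fword_Cons: "fword (g # ws) = fgen g * fword ws"
  by (simp add: fword_def fgen_def mult_single plus_word_def)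

lemma single_eq_fconst_fword: "Poly_Mapping.single w c = fconst c * fword (letters w)"
  by (simp add: fword_def fconst_def mult_single)

lemma free_alg_expand:
  "p = (\<Sum>w\<in>Poly_Mapping.keys p. fconst (Poly_Mapping.lookup p w) * fword (letters w))"
proof -
  have "p = (\<Sum>w\<in>Poly_Mapping.keys p. Poly_Mapping.single w (Poly_Mapping.lookup p w))"
    by (rule poly_mapping_eqI)
      (simp add: lookup_sum lookup_single when_def sum.delta' not_in_keys_iff_lookup_eq_zero)
  then show ?thesis by (simp add: single_eq_fconst_fword)
qed

lemma free_alg_span_induct [case_names zero add scale word]:
  fixes p :: "'k::field free_alg"
  assumes "P 0" and "\<And>p r. P p \<Longrightarrow> P r \<Longrightarrow> P (p + r)" and "\<And>c p. P p \<Longrightarrow> P (fconst c * p)"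
    and "\<And>ws. P (fword ws)"
  shows "P p"
proof -
  have "P (\<Sum>w\<in>A. fconst (f w) * fword (letters w))" if "finite A" for A and f :: "word \<Rightarrow> 'k"
    using that by (induction A) (auto intro: assms)
  from this[OF finite_keys] show ?thesis by (subst free_alg_expand)
qed

lemma free_alg_induct [case_names const gen add mult]:
  fixes p :: "'k::field free_alg"
  assumes const: "\<And>c. P (fconst c)" and gen: "\<And>g. P (fgen g)"
    and add: "\<And>p r. P p \<Longrightarrow> P r \<Longrightarrow> P (p + r)" and mult: "\<And>p r. P p \<Longrightarrow> P r \<Longrightarrow> P (p * r)"
  shows "P p"
proof (induction p rule: free_alg_span_induct)
  case zero show ?case using const[of 0] by simp
next
  case (word ws)
  show ?case
    by (induction ws) (use const[of 1] in \<open>auto simp: fword_Cons gen mult\<close>)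
qed (auto intro: assms)

lemma fconst_commute: "p * fconst c = fconst c * (p :: 'k::field free_alg)"
proof (induction p rule: free_alg_induct)
  case (const d) then show ?case by (simp add: mult.commute flip: fconst_mult)
next
  case (gen g) then show ?case by (simp add: fgen_def fconst_def mult_single)
next
  case (mult p r) then show ?case by (metis mult.assoc)
qed (simp_all add: algebra_simps)

lemma fconst_left_commute: "p * (fconst c * r) = fconst c * (p * r)" for p :: "'k::field free_alg"
  by (metis fconst_commute mult.assoc)

section \<open>Evaluation of polynomials at elements of the free algebra\<close>

definition eval_univ :: "'k::field free_alg \<Rightarrow> 'k poly \<Rightarrow> 'k free_alg" where
  "eval_univ P c = fold_coeffs (\<lambda>a r. fconst a + r * P) c 0"

text \<open>Horner evaluation with the inner variable sent to P, the outer one to Q, and the Q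
  factors to the right of the P factors. As F is not commutative this is no ring homomorphism;
  multiplication by the outer variable is respected exactly, by the inner one only modulo the
  annihilator, when P and Q commute there.\<close>

definition eval_biv :: "'k::field free_alg \<Rightarrow> 'k free_alg \<Rightarrow> 'k poly poly \<Rightarrow> 'k free_alg" where
  "eval_biv P Q f = fold_coeffs (\<lambda>c r. eval_univ P c + r * Q) f 0"

lemma eval_univ_0 [simp]: "eval_univ P 0 = 0"
  by (simp add: eval_univ_def)

lemma eval_univ_pCons [simp]: "eval_univ P (pCons a c) = fconst a + eval_univ P c * P"
  by (cases "a = 0 \<and> c = 0") (auto simp: eval_univ_def)

lemma eval_biv_0 [simp]: "eval_biv P Q 0 = 0"
  by (simp add: eval_biv_def)

lemma eval_biv_pCons [simp]: "eval_biv P Q (pCons c f) = eval_univ P c + eval_biv P Q f * Q"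
  by (cases "c = 0 \<and> f = 0") (auto simp: eval_biv_def)

lemma eval_univ_add: "eval_univ P (c + d) = eval_univ P c + eval_univ P d"
  by (induction c d rule: poly_induct2) (simp_all add: fconst_add algebra_simps)

lemma eval_biv_add: "eval_biv P Q (f + g) = eval_biv P Q f + eval_biv P Q g"
  by (induction f g rule: poly_induct2) (simp_all add: eval_univ_add algebra_simps)

lemma eval_univ_smult: "eval_univ P (smult a c) = fconst a * eval_univ P c"
  by (induction c) (simp_all add: fconst_mult distrib_left mult.assoc)

lemma eval_biv_smult_const: "eval_biv P Q (smult [:a:] f) = fconst a * eval_biv P Q f"
  by (induction f) (simp_all add: eval_univ_smult algebra_simps)

lemma eval_biv_1 [simp]: "eval_biv P Q 1 = 1"
  by (simp add: one_pCons)

lemma eval_univ_linear_mult: "eval_univ P ([:-b, 1:] * f) = eval_univ P f * (P - fconst b)"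
proof -
  have "[:-b, 1:] * f = smult (-b) f + pCons 0 f" by simp
  then show ?thesis
    by (simp only: eval_univ_add eval_univ_smult eval_univ_pCons)
      (simp add: fconst_minus fconst_commute algebra_simps)
qed

lemma eval_univ_monom: "eval_univ P (monom a n) = fconst a * P ^ n"
  by (induction n) (simp_all add: monom_0 monom_Suc power_commutes algebra_simps)

text \<open>J plays the annihilator of a chosen generator, so F/J is the module and
  \<open>p \<in> J\<close> says that p sends the generator to 0. Condition
  \<open>inverse_mod\<close> is simplicity: every nonzero vector can be moved back to the
  generator.\<close>

locale maximal_right_ideal =
  fixes J :: "'k::field free_alg set"
  assumes zero_mem: "0 \<in> J"
    and add_mem: "p \<in> J \<Longrightarrow> r \<in> J \<Longrightarrow> p + r \<in> J"
    and mult_mem: "p \<in> J \<Longrightarrow> p * r \<in> J"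
    and one_not_mem: "1 \<notin> J"
    and inverse_mod: "p \<notin> J \<Longrightarrow> \<exists>r. p * r - 1 \<in> J"
begin

lemma scale_mem: "p \<in> J \<Longrightarrow> fconst c * p \<in> J"
  using mult_mem[of p "fconst c"] by (simp add: fconst_commute)

lemma minus_mem: "p \<in> J \<Longrightarrow> - p \<in> J"
  using mult_mem[of p "-1"] by simp

lemma diff_mem: "p \<in> J \<Longrightarrow> r \<in> J \<Longrightarrow> p - r \<in> J"
  using add_mem[of p "-r"] minus_mem by simp

text \<open>The annihilator of all of F/J, not just of the generator: the largest two-sided ideal
  inside J. Congruence modulo it is equality of operators, whereas congruence modulo J is equality
  of vectors.\<close>

definition Ann :: "'k free_alg set" where
  "Ann = {p. \<forall>s. s * p \<in> J}"

definition cong :: "'k free_alg \<Rightarrow> 'k free_alg \<Rightarrow> bool" (infix "\<approx>" 50) where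
  "p \<approx> r \<longleftrightarrow> p - r \<in> Ann"

lemma Ann_mult_left: "p \<in> Ann \<Longrightarrow> r * p \<in> Ann"
  by (simp add: Ann_def flip: mult.assoc)

lemma Ann_mult_right: "p \<in> Ann \<Longrightarrow> p * r \<in> Ann"
  by (simp add: Ann_def mult_mem flip: mult.assoc)

lemma Ann_add: "p \<in> Ann \<Longrightarrow> r \<in> Ann \<Longrightarrow> p + r \<in> Ann"
  by (simp add: Ann_def add_mem distrib_left)

lemma Ann_minus: "p \<in> Ann \<Longrightarrow> - p \<in> Ann"
  by (simp add: Ann_def minus_mem)

lemma Ann_imp_mem: "p \<in> Ann \<Longrightarrow> p \<in> J"
  unfolding Ann_def by (metis (mono_tags) mem_Collect_eq mult_1)

lemma cong_refl [simp, intro]: "p \<approx> p"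
  by (simp add: cong_def Ann_def zero_mem)

lemma cong_sym: "p \<approx> r \<Longrightarrow> r \<approx> p"
  using Ann_minus[of "p - r"] by (simp add: cong_def)

lemma cong_trans [trans]: "p \<approx> r \<Longrightarrow> r \<approx> t \<Longrightarrow> p \<approx> t"
  using Ann_add[of "p - r" "r - t"] by (simp add: cong_def)

lemma cong_add: "p \<approx> p' \<Longrightarrow> r \<approx> r' \<Longrightarrow> p + r \<approx> p' + r'"
  using Ann_add[of "p - p'" "r - r'"] by (simp add: cong_def algebra_simps)

lemma cong_mult_right: "p \<approx> p' \<Longrightarrow> p * r \<approx> p' * r"
  using Ann_mult_right[of "p - p'" r] by (simp add: cong_def algebra_simps)

lemma cong_mult_left: "p \<approx> p' \<Longrightarrow> r * p \<approx> r * p'"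
  using Ann_mult_left[of "p - p'" r] by (simp add: cong_def algebra_simps)

lemma cong_diff: "p \<approx> p' \<Longrightarrow> r \<approx> r' \<Longrightarrow> p - r \<approx> p' - r'"
  using Ann_add[of "p - p'" "-(r - r')"] Ann_minus[of "r - r'"]
  by (simp add: cong_def algebra_simps)

lemma cong_mem_iff: "p \<approx> r \<Longrightarrow> p \<in> J \<longleftrightarrow> r \<in> J"
proof -
  assume "p \<approx> r"
  then have "p - r \<in> J" by (simp add: cong_def Ann_imp_mem)
  then show ?thesis using add_mem[of "p - r" r] diff_mem[of p "p - r"] by auto
qed

lemma commute_fconst [simp]: "r * fconst c \<approx> fconst c * r"
  by (simp add: fconst_commute)

lemma commuteI:
  assumes "\<And>g. fgen g * c \<approx> c * fgen g"
  shows "r * c \<approx> c * r"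
proof (induction r rule: free_alg_induct)
  case (const d) then show ?case by (simp add: fconst_commute)
next
  case (gen g) then show ?case by (rule assms)
next
  case (add p r)
  then show ?case using cong_add by (simp add: algebra_simps)
next
  case (mult p r)
  have "p * (r * c) \<approx> p * (c * r)" using mult by (intro cong_mult_left)
  also have "p * (c * r) = (p * c) * r" by (simp add: mult.assoc)
  also have "(p * c) * r \<approx> (c * p) * r" using mult by (intro cong_mult_right)
  finally show ?case by (simp add: mult.assoc)
qed

text \<open>The two halves of Schur's lemma: the kernel of a normal element and the image of a central
  element are submodules.\<close>

lemma normal_mem_Ann:
  assumes normal: "\<And>r. \<exists>r'. r * c \<approx> c * r'" and "p \<notin> J" and "p * c \<in> J"
  shows "c \<in> Ann"
  unfolding Ann_def
proof (intro CollectI allI)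
  fix s
  \<comment> \<open>Modulo J the vector s c equals p r s c, and normality turns this into p c r',
    which vanishes.\<close>
  obtain r where r: "p * r - 1 \<in> J" using inverse_mod assms by blast
  obtain r' where r': "(r * s) * c \<approx> c * r'" using normal by blast
  have "p * ((r * s) * c) \<approx> p * (c * r')" using r' by (rule cong_mult_left)
  moreover have "p * (c * r') \<in> J" using assms(3) mult_mem by (simp flip: mult.assoc)
  ultimately have "p * ((r * s) * c) \<in> J" using cong_mem_iff by blast
  moreover have "(p * r - 1) * (s * c) \<in> J" using r by (rule mult_mem)
  ultimately have "p * ((r * s) * c) - (p * r - 1) * (s * c) \<in> J" by (rule diff_mem)
  then show "s * c \<in> J" by (simp add: algebra_simps)
qed

lemma central_mem_Ann_of_unreachable:
  assumes central: "\<And>r. r * c \<approx> c * r" and unreachable: "\<And>p. p * c - e \<notin> J"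
  shows "c \<in> Ann"
proof (rule ccontr)
  assume "c \<notin> Ann"
  then obtain s where "s * c \<notin> J" by (auto simp: Ann_def)
  \<comment> \<open>A nonzero s c is moved back to 1 by r. Multiplying by e and moving c to the
    right exhibits e as the image of s r e under c.\<close>
  then obtain r where r: "s * c * r - 1 \<in> J" using inverse_mod by blast
  have "s * ((r * e) * c) - e \<approx> s * (c * (r * e)) - e"
    by (intro cong_diff cong_mult_left central cong_refl)
  moreover have "s * (c * (r * e)) - e = (s * c * r - 1) * e" by (simp add: algebra_simps)
  moreover have "(s * c * r - 1) * e \<in> J" using r by (rule mult_mem)
  ultimately have "(s * r * e) * c - e \<in> J" using cong_mem_iff by (metis mult.assoc)
  then show False using unreachable by blast
qed

text \<open>Pulled back from \<open>F/J\<close>: a subspace stable under \<open>P\<close> and \<open>Q\<close>.\<close>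

definition stable_subspace :: "'k free_alg \<Rightarrow> 'k free_alg \<Rightarrow> 'k free_alg set \<Rightarrow> bool" where
  "stable_subspace P Q N \<longleftrightarrow> J \<subseteq> N \<and> (\<forall>p\<in>N. \<forall>r\<in>N. p + r \<in> N) \<and>
    (\<forall>c. \<forall>p\<in>N. fconst c * p \<in> N) \<and> (\<forall>p\<in>N. p * P \<in> N \<and> p * Q \<in> N)"

lemma stable_subspaceD:
  assumes "stable_subspace P Q N"
  shows "J \<subseteq> N" "p \<in> N \<Longrightarrow> r \<in> N \<Longrightarrow> p + r \<in> N" "p \<in> N \<Longrightarrow> fconst c * p \<in> N"
    "p \<in> N \<Longrightarrow> p * P \<in> N" "p \<in> N \<Longrightarrow> p * Q \<in> N"
  using assms by (auto simp: stable_subspace_def)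

lemma stable_subspace_diff:
  assumes N: "stable_subspace P Q N" and "p \<in> N" "r \<in> N"
  shows "p - r \<in> N"
  using stable_subspaceD(2)[OF N assms(2) stable_subspaceD(3)[OF N assms(3), of "-1"]]
  by (simp add: fconst_minus)

lemma stable_subspace_cong:
  assumes N: "stable_subspace P Q N" and "p \<approx> r" and "r \<in> N"
  shows "p \<in> N"
proof -
  have "p - r \<in> N" using assms stable_subspaceD(1)[OF N] by (auto simp: cong_def Ann_imp_mem)
  then show ?thesis using stable_subspaceD(2)[OF N _ assms(3)] by fastforce
qed

lemma eval_biv_mult_X:
  assumes PQ: "P * Q \<approx> Q * P"
  shows "eval_biv P Q (smult [:0, 1:] f) \<approx> eval_biv P Q f * P"
proof (induction f)
  case (pCons c f)
  have "eval_biv P Q (smult [:0, 1:] f) * Q \<approx> eval_biv P Q f * P * Q"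
    using pCons by (intro cong_mult_right)
  also have "\<dots> = eval_biv P Q f * (P * Q)" by (simp add: mult.assoc)
  also have "\<dots> \<approx> eval_biv P Q f * (Q * P)" using PQ by (rule cong_mult_left)
  finally have "eval_univ P c * P + eval_biv P Q (smult [:0, 1:] f) * Q
      \<approx> eval_univ P c * P + eval_biv P Q f * (Q * P)"
    by (intro cong_add cong_refl)
  then show ?case by (simp add: algebra_simps)
qed simp

text \<open>Adjoining the generators one at a time, there is a last moment at which the stable
  subspace is proper; the next generator is e. Modulo that subspace the module is cyclic and
  nonzero.\<close>

lemma finite_generation_step:
  assumes "finite E" and "stable_subspace P Q N" and "N \<noteq> UNIV"
    and "\<And>N'. stable_subspace P Q N' \<Longrightarrow> N \<subseteq> N' \<Longrightarrow> E \<subseteq> N' \<Longrightarrow> N' = UNIV"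
  obtains N' e where "stable_subspace P Q N'" and "N' \<noteq> UNIV"
    and "\<And>N''. stable_subspace P Q N'' \<Longrightarrow> N' \<subseteq> N'' \<Longrightarrow> e \<in> N'' \<Longrightarrow> N'' = UNIV"
  using assms
proof (induction E arbitrary: N thesis rule: finite_induct)
  case empty then show ?case by blast
next
  case (insert e E)
  define N1 where "N1 = stable_subspace P Q hull (insert e N)"
  have N1: "stable_subspace P Q N1"
    unfolding N1_def by (rule hull_in) (auto simp: stable_subspace_def)
  have sub: "N \<subseteq> N1" "e \<in> N1" unfolding N1_def using hull_subset by fast+
  show ?case
  proof (cases "N1 = UNIV")
    case True
    have "N'' = UNIV" if "stable_subspace P Q N''" "N \<subseteq> N''" "e \<in> N''" for N''
      using hull_minimal[of "insert e N" N'' "stable_subspace P Q"] that True N1_def by auto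
    then show ?thesis using insert.prems by blast
  next
    case False
    show ?thesis
    proof (rule insert.IH[OF _ N1 False])
      show "N' = UNIV" if "stable_subspace P Q N'" "N1 \<subseteq> N'" "E \<subseteq> N'" for N'
        using insert.prems(4)[OF that(1)] that sub by blast
    qed (use insert.prems(1) in blast)
  qed
qed

end

section \<open>Weak Nullstellensatz for finitely generated modules\<close>

locale alg_closed_maximal_right_ideal = maximal_right_ideal J
  for J :: "'k::alg_closed_field free_alg set"
begin

text \<open>The weak Nullstellensatz for a module generated by a finite set \<open>E\<close> over two commuting
  operators: modulo all but one generator the module is cyclic, so that the annihilator ideal of
  the last one can be specialised.\<close>

lemma finitely_generated_unreachable:
  assumes "finite E" and PQ: "P * Q \<approx> Q * P"
    and gen: "\<And>N. stable_subspace P Q N \<Longrightarrow> E \<subseteq> N \<Longrightarrow> N = UNIV"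
  obtains a e where "\<And>p. p * (P - fconst a) - e \<notin> J"
proof -
  have "stable_subspace P Q J"
    by (simp add: stable_subspace_def add_mem scale_mem mult_mem)
  moreover have "J \<noteq> UNIV" using one_not_mem by auto
  ultimately obtain N e where N: "stable_subspace P Q N" and ne: "N \<noteq> UNIV"
    and max: "\<And>N'. stable_subspace P Q N' \<Longrightarrow> N \<subseteq> N' \<Longrightarrow> e \<in> N' \<Longrightarrow> N' = UNIV"
    using finite_generation_step[OF \<open>finite E\<close>] gen by metis
  note ND = stable_subspaceD[OF N]
  let ?ev = "eval_biv P Q"
  \<comment> \<open>The annihilator of the class of e in F/N. Since evaluation is not
    multiplicative, the ideal property is checked for constants and for each of the two variables
    separately.\<close>
  define I where "I = {f. e * ?ev f \<in> N}"
  have X: "?ev (smult [:0, 1:] f) \<approx> ?ev f * P" for f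
    using PQ by (rule eval_biv_mult_X)
  have I_add: "f + g \<in> I" if "f \<in> I" "g \<in> I" for f g
    using that ND(2) by (simp add: I_def eval_biv_add distrib_left)
  have I_const: "smult [:c:] f \<in> I" if "f \<in> I" for c f
    using that ND(3) by (simp add: I_def eval_biv_smult_const fconst_left_commute)
  have I_X: "smult [:0, 1:] f \<in> I" if "f \<in> I" for f
  proof -
    have "e * ?ev (smult [:0, 1:] f) \<approx> e * (?ev f * P)" using X by (rule cong_mult_left)
    moreover have "e * (?ev f * P) \<in> N"
      using that ND(4) by (simp add: I_def flip: mult.assoc)
    ultimately show ?thesis using stable_subspace_cong[OF N] by (auto simp: I_def)
  qed
  have zero_N: "0 \<in> N" using ND(1) zero_mem by blast
  then have I_0: "0 \<in> I" by (simp add: I_def)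
  have I_smult: "smult c f \<in> I" if "f \<in> I" for c f
  proof (induction c)
    case (pCons a c)
    have "smult (pCons a c) f = smult [:a:] f + smult [:0, 1:] (smult c f)"
      by (simp flip: smult_add_left)
    then show ?case using I_add I_const[OF that] I_X[OF pCons(2)] by metis
  qed (simp add: I_0)
  have I_mult: "h * f \<in> I" if "f \<in> I" for h f
  proof (induction h)
    case (pCons c h)
    have "pCons 0 (h * f) \<in> I" using pCons(2) ND(5) by (simp add: I_def flip: mult.assoc)
    then show ?case using I_add I_smult[OF that] by simp
  qed (simp add: I_0)
  have "e \<notin> N" using max[OF N] ne by blast
  then have I_1: "1 \<notin> I" by (simp add: I_def)
  obtain a where a: "\<And>f u. f \<in> I \<Longrightarrow> f + [:[:-a, 1:]:] * u \<noteq> 1"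
    using bivariate_ideal_specialise[OF I_0 I_add I_mult I_1] by blast
  have ev_shift: "?ev ([:[:-a, 1:]:] * u) \<approx> ?ev u * (P - fconst a)" for u
  proof -
    have "[:[:-a, 1:]:] * u = smult [:0, 1:] u + smult [:-a:] u" by (simp flip: smult_add_left)
    then have "?ev ([:[:-a, 1:]:] * u) = ?ev (smult [:0, 1:] u) + fconst (-a) * ?ev u"
      by (simp only: eval_biv_add eval_biv_smult_const)
    also have "\<dots> \<approx> ?ev u * P + fconst (-a) * ?ev u" by (intro cong_add X cong_refl)
    finally show ?thesis by (simp add: fconst_minus fconst_commute algebra_simps)
  qed
  \<comment> \<open>Cyclicity modulo N: the left side is stable and contains N and e.\<close>
  have span: "{n + e * ?ev u | n u. n \<in> N} = UNIV" (is "?S = _")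
  proof (rule max)
    have "p + r \<in> ?S" if pr: "p \<in> ?S" "r \<in> ?S" for p r
    proof -
      obtain n u m v where "p = n + e * ?ev u" "n \<in> N" "r = m + e * ?ev v" "m \<in> N"
        using pr by blast
      then have "p + r = (n + m) + e * ?ev (u + v)" "n + m \<in> N"
        using ND(2) by (simp_all add: eval_biv_add algebra_simps)
      then show ?thesis by blast
    qed
    moreover have "fconst c * p \<in> ?S" if p: "p \<in> ?S" for c p
    proof -
      obtain n u where "p = n + e * ?ev u" "n \<in> N" using p by blast
      then have "fconst c * p = fconst c * n + e * ?ev (smult [:c:] u)" "fconst c * n \<in> N"
        using ND(3) by (simp_all only: eval_biv_smult_const distrib_left fconst_left_commute)
      then show ?thesis by blast
    qed
    moreover have "p * P \<in> ?S" if p: "p \<in> ?S" for p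
    proof -
      obtain n u where nu: "p = n + e * ?ev u" "n \<in> N" using p by blast
      let ?n = "p * P - e * ?ev (smult [:0, 1:] u)"
      have "?n \<approx> p * P - e * (?ev u * P)"
        by (intro cong_diff cong_mult_left X cong_refl)
      also have "\<dots> = n * P" by (simp add: nu algebra_simps)
      finally have "?n \<in> N" using ND(4)[OF nu(2)] stable_subspace_cong[OF N] by blast
      moreover have "p * P = ?n + e * ?ev (smult [:0, 1:] u)" by simp
      ultimately show ?thesis by blast
    qed
    moreover have "p * Q \<in> ?S" if p: "p \<in> ?S" for p
    proof -
      obtain n u where nu: "p = n + e * ?ev u" "n \<in> N" using p by blast
      then have "p * Q = n * Q + e * ?ev (pCons 0 u)" "n * Q \<in> N"
        using ND(5) by (simp_all add: algebra_simps)
      then show ?thesis by blast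
    qed
    moreover show "N \<subseteq> ?S"
    proof
      fix n assume "n \<in> N"
      moreover have "n = n + e * ?ev 0" by simp
      ultimately show "n \<in> ?S" by blast
    qed
    ultimately show "stable_subspace P Q ?S" using ND(1) by (auto simp: stable_subspace_def)
    have "e = 0 + e * ?ev 1" by simp
    then show "e \<in> ?S" using zero_N by blast
  qed
  show ?thesis
  proof (rule that[of a e], rule notI)
    \<comment> \<open>Writing p as n + e u, reachability of e would place 1 - (x - a) u in I, which
      the choice of a forbids.\<close>
    fix p assume p: "p * (P - fconst a) - e \<in> J"
    have "p \<in> {n + e * ?ev u | n u. n \<in> N}" unfolding span by simp
    then obtain n u where nu: "p = n + e * ?ev u" "n \<in> N" by blast
    let ?u = "[:[:-a, 1:]:] * u"
    have "?ev (1 - ?u) = 1 - ?ev ?u"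
      using eval_biv_add[of P Q "1 - ?u" ?u] by (simp add: algebra_simps)
    then have "e * ?ev (1 - ?u) = e - e * ?ev ?u" by (simp only: right_diff_distrib mult_1_right)
    also have "\<dots> \<approx> e - e * (?ev u * (P - fconst a))"
      by (intro cong_diff cong_mult_left ev_shift cong_refl)
    also have "\<dots> = (n * P - fconst a * n) - (p * (P - fconst a) - e)"
      by (simp add: nu fconst_commute algebra_simps) (rule fconst_left_commute)
    finally have *: "e * ?ev (1 - ?u) \<approx> (n * P - fconst a * n) - (p * (P - fconst a) - e)" .
    have "p * (P - fconst a) - e \<in> N" using p ND(1) by blast
    with nu(2) have "(n * P - fconst a * n) - (p * (P - fconst a) - e) \<in> N"
      by (intro stable_subspace_diff[OF N _ \<open>p * (P - fconst a) - e \<in> N\<close>]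
          stable_subspace_diff[OF N] ND(3,4))
    then have "1 - ?u \<in> I" using stable_subspace_cong[OF N *] by (simp add: I_def)
    then show False using a[of "1 - ?u" u] by simp
  qed
qed

end

lemmas fconst_normalise =
  fconst_commute[of "fgen _"] fconst_commute[of "_ ^ _"]
  fconst_left_commute[of "fgen _"] fconst_left_commute[of "_ ^ _"]

lemma fconst_collect: "fconst a * (fconst b * p) = fconst (a * b) * (p :: 'k::field free_alg)"
  by (simp add: fconst_mult mult.assoc)

context maximal_right_ideal
begin

text \<open>\<open>m\<^sub>k \<mapsto> T k\<close> extends to a homomorphism from the module given by the table \<open>b\<close> to \<open>F/J\<close>
  as soon as the images of the basis vectors transform according to \<open>b\<close>.\<close>

lemma free_act_lift:
  assumes T: "\<And>h k. k < l \<Longrightarrow> T k * fgen h - (\<Sum>j<l. fconst (b h k j) * T j) \<in> J"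
  shows "(\<Sum>k<l. fconst (f k) * T k) * p - (\<Sum>k<l. fconst (free_act l b p f k) * T k) \<in> J"
proof -
  define \<Psi> where "\<Psi> f = (\<Sum>k<l. fconst (f k) * T k)" for f
  have sum_mem: "sum h A \<in> J" if "\<And>k. k \<in> A \<Longrightarrow> h k \<in> J" for h :: "'b \<Rightarrow> 'k free_alg" and A
    using that by (induction A rule: infinite_finite_induct) (auto simp: zero_mem add_mem)
  have fconst_sum: "fconst (sum c A) = (\<Sum>k\<in>A. fconst (c k))" for c :: "'b \<Rightarrow> 'k" and A
    by (induction A rule: infinite_finite_induct) (auto simp: fconst_add)
  have gen: "\<Psi> f * fgen h - \<Psi> (lin_ext l (b h) f) \<in> J" for h f
  proof -
    have "\<Psi> (lin_ext l (b h) f) = (\<Sum>i<l. \<Sum>k<l. fconst (f k) * (fconst (b h k i) * T i))"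
      by (simp add: \<Psi>_def lin_ext_def fconst_sum sum_distrib_right fconst_mult mult.assoc)
    also have "\<dots> = (\<Sum>k<l. fconst (f k) * (\<Sum>i<l. fconst (b h k i) * T i))"
      by (subst sum.swap) (simp add: sum_distrib_left)
    finally have "\<Psi> f * fgen h - \<Psi> (lin_ext l (b h) f)
        = (\<Sum>k<l. fconst (f k) * (T k * fgen h - (\<Sum>i<l. fconst (b h k i) * T i)))"
      by (simp add: \<Psi>_def sum_distrib_right sum_subtractf right_diff_distrib mult.assoc)
    also have "\<dots> \<in> J" using T by (intro sum_mem scale_mem) auto
    finally show ?thesis .
  qed
  have word: "\<Psi> f * fword ws - \<Psi> (fold (\<lambda>g. lin_ext l (b g)) ws f) \<in> J" for ws f
  proof (induction ws arbitrary: f)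
    case (Cons h ws)
    let ?f = "lin_ext l (b h) f"
    \<comment> \<open>The error made at the first letter lies in J and stays there under right
      multiplication by the remaining letters.\<close>
    have "(\<Psi> f * fgen h - \<Psi> ?f) * fword ws
        + (\<Psi> ?f * fword ws - \<Psi> (fold (\<lambda>g. lin_ext l (b g)) ws ?f)) \<in> J"
      using gen Cons by (intro add_mem mult_mem)
    then show ?case by (simp add: fword_Cons algebra_simps)
  qed (simp add: zero_mem)
  let ?K = "Poly_Mapping.keys p" and ?c = "Poly_Mapping.lookup p"
  have "\<Psi> (free_act l b p f) = (\<Sum>w\<in>?K. fconst (?c w) * \<Psi> (fold (\<lambda>g. lin_ext l (b g)) (letters w) f))"
    unfolding \<Psi>_def free_act_def
    by (simp add: fconst_sum sum_distrib_right sum_distrib_left fconst_mult mult.assoc)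
      (rule sum.swap)
  moreover have "\<Psi> f * p = (\<Sum>w\<in>?K. fconst (?c w) * (\<Psi> f * fword (letters w)))"
    by (subst (1) free_alg_expand[of p]) (simp add: sum_distrib_left fconst_left_commute)
  ultimately have "\<Psi> f * p - \<Psi> (free_act l b p f)
      = (\<Sum>w\<in>?K. fconst (?c w) * (\<Psi> f * fword (letters w) - \<Psi> (fold (\<lambda>g. lin_ext l (b g)) (letters w) f)))"
    by (simp add: sum_subtractf right_diff_distrib)
  also have "\<dots> \<in> J" by (intro sum_mem scale_mem word)
  finally show ?thesis by (simp add: \<Psi>_def)
qed

text \<open>Whatever kills m_0 in the table module also kills the vector \<open>T 0\<close>. This
  inclusion is all that the comparison of two simple modules will ask for.\<close>

lemma free_act_lift_annihilator:
  assumes T: "\<And>h k. k < l \<Longrightarrow> T k * fgen h - (\<Sum>j<l. fconst (b h k j) * T j) \<in> J"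
    and "0 < l" and "free_act l b p (bvec 1 0) = (\<lambda>i. 0)"
  shows "T 0 * p \<in> J"
proof -
  have "(\<Sum>k<l. fconst (bvec 1 0 k) * T k) = T 0"
    using \<open>0 < l\<close> by (simp add: bvec_def if_distrib[of fconst] if_distrib[of "\<lambda>c. c * _"] cong: if_cong)
  then show ?thesis using free_act_lift[of l T b "bvec 1 0" p, OF T] assms(3) by simp
qed

lemma sum_bvec: "j < l \<Longrightarrow> (\<Sum>i<l. fconst (bvec c j i) * T i) = fconst c * T j"
  by (simp add: bvec_def if_distrib[of fconst] if_distrib[of "\<lambda>c. c * _"] cong: if_cong)

end

text \<open>Here t stands for q^2. The defining relations are operator identities on F/J, hence
  congruences modulo \<open>Ann\<close>, while nilpotence of z is recorded at the generator and
  injectivity of g at every vector.\<close>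

locale quantum_right_ideal = alg_closed_maximal_right_ideal J
  for J :: "'k::alg_closed_field free_alg set" +
  fixes t \<alpha> :: 'k and l :: nat
  assumes t_root: "is_primitive_root_of_unity l t" and l_gt_1: "l > 1"
    and xy: "fgen GX * fgen GY \<approx> fconst t * fgen GY * fgen GX + fconst \<alpha>"
    and xz: "fgen GX * fgen GZ \<approx> fconst (inverse t) * fgen GZ * fgen GX"
    and yz: "fgen GY * fgen GZ \<approx> fconst t * fgen GZ * fgen GY"
    and z_nilpotent: "\<exists>n. fgen GZ ^ n \<in> J"
    and g_injective: "p * (fgen GX * fgen GY - fgen GY * fgen GX) \<in> J \<Longrightarrow> p \<in> J"
begin

section \<open>Commutation rules and central powers\<close>

abbreviation gx :: "'k free_alg" where "gx \<equiv> fgen GX"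
abbreviation gy :: "'k free_alg" where "gy \<equiv> fgen GY"
abbreviation gz :: "'k free_alg" where "gz \<equiv> fgen GZ"
abbreviation gg :: "'k free_alg" where "gg \<equiv> gx * gy - gy * gx"

lemma t_pow_l: "t ^ l = 1" and t_nz: "t \<noteq> 0" and t_ne_1: "t \<noteq> 1"
proof -
  show 1: "t ^ l = 1" using t_root by (simp add: is_primitive_root_of_unity_def)
  then show "t \<noteq> 0" using l_gt_1 by (auto simp: power_0_left)
  have "t ^ 1 \<noteq> 1" using t_root l_gt_1 unfolding is_primitive_root_of_unity_def by blast
  then show "t \<noteq> 1" by simp
qed

lemma last_power_not_mem:
  assumes "p ^ n \<in> J"
  obtains m where "p ^ m \<notin> J" "p ^ Suc m \<in> J"
proof -
  have "\<exists>m. p ^ m \<notin> J \<and> p ^ Suc m \<in> J"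
    using assms one_not_mem by (induction n) auto
  then show ?thesis using that by blast
qed

lemma z_normal: "\<exists>r'. r * gz \<approx> gz * r'"
proof (induction r rule: free_alg_induct)
  case (const c) show ?case by (intro exI[of _ "fconst c"]) (simp add: fconst_commute)
next
  case (gen g)
  show ?case
  proof (cases g)
    case GX
    then have "fgen g * gz \<approx> gz * (fconst (inverse t) * gx)"
      using xz by (simp add: fconst_left_commute mult.assoc)
    then show ?thesis by blast
  next
    case GY
    then have "fgen g * gz \<approx> gz * (fconst t * gy)"
      using yz by (simp add: fconst_left_commute mult.assoc)
    then show ?thesis by blast
  qed auto
next
  case (add p r)
  then obtain p' r' where "p * gz \<approx> gz * p'" "r * gz \<approx> gz * r'" by blast
  then have "(p + r) * gz \<approx> gz * (p' + r')" by (simp add: distrib_left distrib_right cong_add)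
  then show ?case by blast
next
  case (mult p r)
  then obtain p' r' where "p * gz \<approx> gz * p'" "r * gz \<approx> gz * r'" by blast
  then have "p * (r * gz) \<approx> p * (gz * r')" "(p * gz) * r' \<approx> (gz * p') * r'"
    by (simp_all add: cong_mult_left cong_mult_right)
  then have "(p * r) * gz \<approx> gz * (p' * r')" using cong_trans by (simp add: mult.assoc)
  then show ?case by blast
qed

lemma z_Ann: "gz \<in> Ann"
proof -
  obtain m where "gz ^ m \<notin> J" "gz ^ m * gz \<in> J"
    using z_nilpotent last_power_not_mem by (metis power_Suc2)
  then show ?thesis using normal_mem_Ann[of gz] z_normal by blast
qed

lemma cong_0_iff: "p \<approx> 0 \<longleftrightarrow> p \<in> Ann"
  by (simp add: cong_def)

lemma central_of_commute_xy:
  assumes "gx * c \<approx> c * gx" "gy * c \<approx> c * gy"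
  shows "r * c \<approx> c * r"
proof (rule commuteI)
  have "gz * c \<approx> 0" "c * gz \<approx> 0" by (simp_all add: cong_0_iff z_Ann Ann_mult_left Ann_mult_right)
  then have "gz * c \<approx> c * gz" using cong_sym cong_trans by blast
  then show "fgen g * c \<approx> c * fgen g" for g by (cases g) (use assms in auto)
qed

text \<open>The quantum integer [k] at t. It vanishes at k = l, which is why the l-th powers of x
  and y become central.\<close>

definition qsum :: "nat \<Rightarrow> 'k" where "qsum k = (\<Sum>i<k. t ^ i)"

lemma qsum_eq: "qsum k = (t ^ k - 1) / (t - 1)"
  using t_ne_1 by (simp add: qsum_def geometric_sum)

text \<open>Moving y through x one factor at a time collects the quantum integer. At k = 0 the
  truncated exponent k - 1 is harmless, because \<open>qsum 0\<close> is 0; at k = l the rule says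
  that x^l and y commute.\<close>

lemma xpow_y: "gx ^ k * gy \<approx> fconst (t ^ k) * (gy * gx ^ k) + fconst (\<alpha> * qsum k) * gx ^ (k - 1)"
proof (induction k)
  case 0 then show ?case by (simp add: qsum_def)
next
  case (Suc k)
  have *: "gx * (fconst (\<alpha> * qsum k) * gx ^ (k - 1)) = fconst (\<alpha> * qsum k) * gx ^ k"
    by (cases k) (simp_all add: qsum_def fconst_normalise)
  have "gx ^ Suc k * gy = gx * (gx ^ k * gy)" by (simp add: mult.assoc)
  also have "\<dots> \<approx> gx * (fconst (t ^ k) * (gy * gx ^ k) + fconst (\<alpha> * qsum k) * gx ^ (k - 1))"
    using Suc by (rule cong_mult_left)
  also have "\<dots> = fconst (t ^ k) * ((gx * gy) * gx ^ k) + fconst (\<alpha> * qsum k) * gx ^ k"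
    by (simp only: distrib_left *) (simp add: fconst_normalise mult.assoc)
  also have "\<dots> \<approx> fconst (t ^ k) * ((fconst t * gy * gx + fconst \<alpha>) * gx ^ k)
      + fconst (\<alpha> * qsum k) * gx ^ k"
    by (intro cong_add cong_mult_left cong_mult_right xy cong_refl)
  also have "\<dots> = fconst (t ^ Suc k) * (gy * gx ^ Suc k) + fconst (\<alpha> * qsum (Suc k)) * gx ^ k"
    by (simp add: qsum_def fconst_collect fconst_add algebra_simps flip: fconst_mult)
  finally show ?case by simp
qed

lemma x_ypow: "gx * gy ^ k \<approx> fconst (t ^ k) * (gy ^ k * gx) + fconst (\<alpha> * qsum k) * gy ^ (k - 1)"
proof (induction k)
  case 0 then show ?case by (simp add: qsum_def)
next
  case (Suc k)
  have *: "(fconst (\<alpha> * qsum k) * gy ^ (k - 1)) * gy = fconst (\<alpha> * qsum k) * gy ^ k"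
    by (cases k) (simp_all add: qsum_def power_commutes mult.assoc)
  have "gx * gy ^ Suc k = (gx * gy ^ k) * gy" by (simp add: mult.assoc power_commutes)
  also have "\<dots> \<approx> (fconst (t ^ k) * (gy ^ k * gx) + fconst (\<alpha> * qsum k) * gy ^ (k - 1)) * gy"
    using Suc by (rule cong_mult_right)
  also have "\<dots> = fconst (t ^ k) * (gy ^ k * (gx * gy)) + fconst (\<alpha> * qsum k) * gy ^ k"
    by (simp only: distrib_right *) (simp add: mult.assoc)
  also have "\<dots> \<approx> fconst (t ^ k) * (gy ^ k * (fconst t * gy * gx + fconst \<alpha>))
      + fconst (\<alpha> * qsum k) * gy ^ k"
    by (intro cong_add cong_mult_left xy cong_refl)
  also have "\<dots> = fconst (t ^ Suc k) * (gy ^ Suc k * gx) + fconst (\<alpha> * qsum (Suc k)) * gy ^ k"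
    by (simp add: qsum_def fconst_collect fconst_add fconst_normalise power_commutes
        algebra_simps flip: fconst_mult) (simp add: power_commutes flip: mult.assoc)
  finally show ?case by simp
qed

lemma qsum_l [simp]: "qsum l = 0"
  by (simp add: qsum_eq t_pow_l)

lemma x_power_l_central: "r * gx ^ l \<approx> gx ^ l * r"
proof (rule central_of_commute_xy)
  show "gy * gx ^ l \<approx> gx ^ l * gy" using xpow_y[of l] by (simp add: t_pow_l cong_sym)
qed (simp add: power_commutes)

lemma y_power_l_central: "r * gy ^ l \<approx> gy ^ l * r"
proof (rule central_of_commute_xy)
  show "gx * gy ^ l \<approx> gy ^ l * gx" using x_ypow[of l] by (simp add: t_pow_l)
qed (simp add: power_commutes)

text \<open>\<open>x_ypow\<close> solved for y^k x, possible because t is invertible. It is the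
  rewriting rule that brings words into the order x before y.\<close>

lemma ypow_x: "gy ^ k * gx \<approx> fconst (inverse (t ^ k)) * (gx * gy ^ k)
    - fconst (inverse (t ^ k) * (\<alpha> * qsum k)) * gy ^ (k - 1)"
proof -
  have "fconst (inverse (t ^ k)) * (gx * gy ^ k) \<approx> fconst (inverse (t ^ k)) *
      (fconst (t ^ k) * (gy ^ k * gx) + fconst (\<alpha> * qsum k) * gy ^ (k - 1))"
    by (intro cong_mult_left x_ypow)
  also have "\<dots> = gy ^ k * gx + fconst (inverse (t ^ k) * (\<alpha> * qsum k)) * gy ^ (k - 1)"
    using t_nz by (simp add: distrib_left fconst_collect)
  finally have "fconst (inverse (t ^ k)) * (gx * gy ^ k)
        - fconst (inverse (t ^ k) * (\<alpha> * qsum k)) * gy ^ (k - 1)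
      \<approx> gy ^ k * gx + fconst (inverse (t ^ k) * (\<alpha> * qsum k)) * gy ^ (k - 1)
        - fconst (inverse (t ^ k) * (\<alpha> * qsum k)) * gy ^ (k - 1)"
    by (intro cong_diff cong_refl)
  then show ?thesis by (simp add: cong_sym)
qed

text \<open>Normal ordering: the letters of a word are absorbed one by one into x^i y^j. A letter y
  raises j, a letter x passes to the left through y^j with a correction term of smaller j, and a
  letter z kills the word.\<close>

lemma monomials_span:
  assumes N: "stable_subspace P Q N" and mono: "\<And>i j. gx ^ i * gy ^ j \<in> N"
  shows "N = UNIV"
proof -
  note ND = stable_subspaceD[OF N]
  have "gx ^ i * gy ^ j * fword ws \<in> N" for i j ws
  proof (induction ws arbitrary: i j)
    case Nil then show ?case using mono by simp
  next
    case (Cons h ws)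
    show ?case
    proof (cases h)
      case GX
      let ?c = "inverse (t ^ j)" and ?d = "inverse (t ^ j) * (\<alpha> * qsum j)"
      have "gx ^ i * gy ^ j * fword (h # ws) = gx ^ i * (gy ^ j * gx) * fword ws"
        by (simp add: GX fword_Cons mult.assoc)
      also have "\<dots> \<approx> gx ^ i * (fconst ?c * (gx * gy ^ j) - fconst ?d * gy ^ (j - 1)) * fword ws"
        by (intro cong_mult_left cong_mult_right ypow_x)
      also have "\<dots> = fconst ?c * (gx ^ Suc i * gy ^ j * fword ws) - fconst ?d * (gx ^ i * gy ^ (j - 1) * fword ws)"
        by (simp add: right_diff_distrib left_diff_distrib fconst_normalise mult.assoc power_Suc2
            del: power_Suc)
      finally show ?thesis
        by (rule stable_subspace_cong[OF N]) (intro stable_subspace_diff[OF N] ND(3) Cons)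
    next
      case GY
      have "gx ^ i * gy ^ j * fword (h # ws) = gx ^ i * gy ^ Suc j * fword ws"
        by (simp add: GY fword_Cons mult.assoc power_Suc2 del: power_Suc)
      then show ?thesis using Cons by metis
    next
      case GZ
      have "gx ^ i * gy ^ j * (gz * fword ws) \<in> Ann"
        by (intro Ann_mult_left Ann_mult_right z_Ann)
      then show ?thesis using ND(1) Ann_imp_mem by (auto simp: GZ fword_Cons)
    qed
  qed
  from this[of 0 0] have w: "fword ws \<in> N" for ws by simp
  have "p \<in> N" for p
    by (induction p rule: free_alg_span_induct) (use w ND zero_mem in auto)
  then show ?thesis by blast
qed

definition basic_monomials :: "'k free_alg set" where
  "basic_monomials = (\<lambda>(i, j). gx ^ i * gy ^ j) ` ({..<l} \<times> {..<l})"

lemma finite_basic_monomials: "finite basic_monomials"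
  by (simp add: basic_monomials_def)

lemma basic_monomials_span:
  assumes N: "stable_subspace (gx ^ l) (gy ^ l) N" and B: "basic_monomials \<subseteq> N"
  shows "N = UNIV"
proof (rule monomials_span[OF N])
  fix i j
  show "gx ^ i * gy ^ j \<in> N"
  proof (induction "i + j" arbitrary: i j rule: less_induct)
    case less
    consider "i < l" "j < l" | "l \<le> i" | "l \<le> j" by linarith
    then show ?case
    proof cases
      case 1 then show ?thesis using B by (auto simp: basic_monomials_def)
    next
      case 2
      then have "gx ^ (i - l) * gx ^ l = gx ^ i" by (simp flip: power_add)
      then have "gx ^ i * gy ^ j = gx ^ (i - l) * (gx ^ l * gy ^ j)" by (simp flip: mult.assoc)
      \<comment> \<open>Centrality carries x^l to the right end, where stability of N
        applies.\<close>
      also have "\<dots> \<approx> gx ^ (i - l) * (gy ^ j * gx ^ l)"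
        by (intro cong_mult_left cong_sym[OF x_power_l_central])
      also have "\<dots> = (gx ^ (i - l) * gy ^ j) * gx ^ l" by (simp add: mult.assoc)
      finally show ?thesis
        using stable_subspace_cong[OF N] stable_subspaceD(4)[OF N] less[of "i - l" j] 2 l_gt_1 by simp
    next
      case 3
      then have "gy ^ (j - l) * gy ^ l = gy ^ j" by (simp flip: power_add)
      then have "gx ^ i * gy ^ j = (gx ^ i * gy ^ (j - l)) * gy ^ l" by (simp add: mult.assoc)
      then show ?thesis using stable_subspaceD(5)[OF N] less[of i "j - l"] 3 l_gt_1 by simp
    qed
  qed
qed

section \<open>Scalars by which the central powers act\<close>

lemma x_power_l_scalar: "\<exists>a. gx ^ l \<approx> fconst a"
proof -
  obtain a e where "\<And>p. p * (gx ^ l - fconst a) - e \<notin> J"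
    using finitely_generated_unreachable[OF finite_basic_monomials x_power_l_central[THEN cong_sym]]
      basic_monomials_span by metis
  moreover have "r * (gx ^ l - fconst a) \<approx> (gx ^ l - fconst a) * r" for r
    by (simp add: right_diff_distrib left_diff_distrib cong_diff x_power_l_central)
  ultimately show ?thesis
    using central_mem_Ann_of_unreachable unfolding cong_def by metis
qed

lemma y_power_l_scalar: "\<exists>b. gy ^ l \<approx> fconst b"
proof -
  have "stable_subspace (gy ^ l) (gx ^ l) N \<Longrightarrow> stable_subspace (gx ^ l) (gy ^ l) N" for N
    by (auto simp: stable_subspace_def)
  then obtain b e where "\<And>p. p * (gy ^ l - fconst b) - e \<notin> J"
    using finitely_generated_unreachable[OF finite_basic_monomials x_power_l_central]
      basic_monomials_span by metis
  moreover have "r * (gy ^ l - fconst b) \<approx> (gy ^ l - fconst b) * r" for r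
    by (simp add: right_diff_distrib left_diff_distrib cong_diff y_power_l_central)
  ultimately show ?thesis
    using central_mem_Ann_of_unreachable unfolding cong_def by metis
qed

section \<open>The element g and its eigenvectors\<close>

lemma gg_eq: "gg \<approx> fconst (t - 1) * (gy * gx) + fconst \<alpha>"
proof -
  have "gg \<approx> (fconst t * gy * gx + fconst \<alpha>) - gy * gx" by (intro cong_diff xy cong_refl)
  also have "\<dots> = fconst (t - 1) * (gy * gx) + fconst \<alpha>" by (simp add: fconst_diff algebra_simps)
  finally show ?thesis .
qed

text \<open>Eliminating y x between the first relation and \<open>gg_eq\<close> makes x y an affine
  function of g. This is the origin of the fractions with denominator q^2 - 1 in the action of y on
  M_6.\<close>

lemma xy_eq_gg: "gx * gy \<approx> fconst (t / (t - 1)) * gg - fconst (\<alpha> / (t - 1))"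
proof -
  let ?s = "inverse (t - 1)"
  have "fconst ?s * (fconst t * gg - fconst \<alpha>)
      \<approx> fconst ?s * (fconst t * (fconst (t - 1) * (gy * gx) + fconst \<alpha>) - fconst \<alpha>)"
    by (intro cong_mult_left cong_diff cong_refl gg_eq)
  also have "\<dots> = fconst (?s * t * (t - 1)) * (gy * gx) + fconst (?s * (t * \<alpha> - \<alpha>))"
    by (simp add: distrib_left right_diff_distrib left_diff_distrib fconst_collect mult.assoc fconst_diff
        flip: fconst_mult)
  also have "?s * t * (t - 1) = t" using t_ne_1 by simp
  also have "?s * (t * \<alpha> - \<alpha>) = \<alpha>" using t_ne_1 by (simp add: field_simps)
  also have "fconst t * (gy * gx) + fconst \<alpha> \<approx> gx * gy"
    using xy by (simp add: mult.assoc cong_sym)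
  finally have "fconst ?s * (fconst t * gg - fconst \<alpha>) \<approx> gx * gy" .
  moreover have "fconst ?s * (fconst t * gg - fconst \<alpha>)
      = fconst (t / (t - 1)) * gg - fconst (\<alpha> / (t - 1))"
    by (simp add: right_diff_distrib fconst_collect divide_inverse mult.commute flip: fconst_mult)
  ultimately show ?thesis using cong_sym by simp
qed

text \<open>Consequently x maps a g-eigenvector with eigenvalue c to a vector on which g acts by t
  c; the powers of x thus run through eigenvalues t^k c.\<close>

lemma x_gg: "gx * gg \<approx> fconst t * (gg * gx)"
proof -
  have "gx * gg \<approx> gx * (fconst (t - 1) * (gy * gx) + fconst \<alpha>)"
    by (intro cong_mult_left gg_eq)
  also have "\<dots> = fconst (t - 1) * ((gx * gy) * gx) + fconst \<alpha> * gx"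
    by (simp only: distrib_left fconst_normalise mult.assoc)
  also have "\<dots> \<approx> fconst (t - 1) * ((fconst t * gy * gx + fconst \<alpha>) * gx) + fconst \<alpha> * gx"
    by (intro cong_add cong_mult_left cong_mult_right xy cong_refl)
  also have "\<dots> = fconst t * ((fconst (t - 1) * (gy * gx) + fconst \<alpha>) * gx)"
    by (simp add: fconst_diff distrib_left distrib_right left_diff_distrib right_diff_distrib
        mult.assoc)
  also have "\<dots> \<approx> fconst t * (gg * gx)"
    by (intro cong_mult_left cong_mult_right cong_sym[OF gg_eq])
  finally show ?thesis .
qed

lemma gg_y: "gg * gy \<approx> fconst t * (gy * gg)"
proof -
  have "gg * gy \<approx> (fconst (t - 1) * (gy * gx) + fconst \<alpha>) * gy"
    by (intro cong_mult_right gg_eq)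
  also have "\<dots> = fconst (t - 1) * (gy * (gx * gy)) + fconst \<alpha> * gy"
    by (simp only: distrib_right mult.assoc)
  also have "\<dots> \<approx> fconst (t - 1) * (gy * (fconst t * gy * gx + fconst \<alpha>)) + fconst \<alpha> * gy"
    by (intro cong_add cong_mult_left xy cong_refl)
  also have "\<dots> = fconst t * (gy * (fconst (t - 1) * (gy * gx) + fconst \<alpha>))"
    by (simp add: fconst_diff distrib_left distrib_right left_diff_distrib right_diff_distrib
        mult.assoc fconst_normalise)
  also have "\<dots> \<approx> fconst t * (gy * gg)"
    by (intro cong_mult_left cong_sym[OF gg_eq])
  finally show ?thesis .
qed

lemma xpow_gg: "gx ^ n * gg \<approx> fconst (t ^ n) * (gg * gx ^ n)"
proof (induction n)
  case (Suc n)
  have "gx ^ Suc n * gg = gx * (gx ^ n * gg)" by (simp add: mult.assoc)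
  also have "\<dots> \<approx> gx * (fconst (t ^ n) * (gg * gx ^ n))" using Suc by (rule cong_mult_left)
  also have "\<dots> = fconst (t ^ n) * ((gx * gg) * gx ^ n)"
    by (simp only: fconst_normalise mult.assoc)
  also have "\<dots> \<approx> fconst (t ^ n) * ((fconst t * (gg * gx)) * gx ^ n)"
    by (intro cong_mult_left cong_mult_right x_gg)
  also have "\<dots> = fconst (t ^ Suc n) * (gg * gx ^ Suc n)"
    by (simp only: mult.assoc fconst_collect power_Suc mult.commute[of t])
  finally show ?case .
qed simp

lemma x_ggpow: "gx * gg ^ n \<approx> fconst (t ^ n) * (gg ^ n * gx)"
proof (induction n)
  case (Suc n)
  have "gx * gg ^ Suc n = (gx * gg ^ n) * gg" by (simp only: power_Suc2 mult.assoc)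
  also have "\<dots> \<approx> (fconst (t ^ n) * (gg ^ n * gx)) * gg" using Suc by (rule cong_mult_right)
  also have "\<dots> = fconst (t ^ n) * (gg ^ n * (gx * gg))" by (simp only: mult.assoc)
  also have "\<dots> \<approx> fconst (t ^ n) * (gg ^ n * (fconst t * (gg * gx)))"
    by (intro cong_mult_left x_gg)
  also have "\<dots> = fconst (t ^ Suc n) * (gg ^ Suc n * gx)"
    by (simp only: mult.assoc fconst_collect power_Suc2 fconst_normalise)
  finally show ?case .
qed simp

lemma ggpow_y: "gg ^ n * gy \<approx> fconst (t ^ n) * (gy * gg ^ n)"
proof (induction n)
  case (Suc n)
  have "gg ^ Suc n * gy = gg * (gg ^ n * gy)" by (simp only: power_Suc mult.assoc)
  also have "\<dots> \<approx> gg * (fconst (t ^ n) * (gy * gg ^ n))" using Suc by (rule cong_mult_left)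
  also have "\<dots> = fconst (t ^ n) * ((gg * gy) * gg ^ n)"
    by (simp only: fconst_left_commute[of gg] mult.assoc)
  also have "\<dots> \<approx> fconst (t ^ n) * ((fconst t * (gy * gg)) * gg ^ n)"
    by (intro cong_mult_left cong_mult_right gg_y)
  also have "\<dots> = fconst (t ^ Suc n) * (gy * gg ^ Suc n)"
    by (simp only: mult.assoc fconst_collect power_Suc mult.commute[of t])
  finally show ?case .
qed simp

lemma gg_power_l_central: "r * gg ^ l \<approx> gg ^ l * r"
proof (rule central_of_commute_xy)
  show "gx * gg ^ l \<approx> gg ^ l * gx" using x_ggpow[of l] by (simp add: t_pow_l)
  show "gy * gg ^ l \<approx> gg ^ l * gy" using ggpow_y[of l] by (simp add: t_pow_l cong_sym)
qed

text \<open>With x^l and y^l scalar, the finitely many basic monomials span the module over K alone,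
  hence over K[g]. The Nullstellensatz gives a vector missed by g - c, and this is transferred to
  the central element g^l.\<close>

lemma gg_power_l_scalar: "\<exists>c. gg ^ l \<approx> fconst c"
proof -
  obtain a b where a: "gx ^ l \<approx> fconst a" and b: "gy ^ l \<approx> fconst b"
    using x_power_l_scalar y_power_l_scalar by blast
  have span: "N = UNIV" if N: "stable_subspace gg 1 N" and B: "basic_monomials \<subseteq> N" for N
  proof -
    have "p * gx ^ l \<in> N" "p * gy ^ l \<in> N" if "p \<in> N" for p
    proof -
      have "fconst a * p \<in> N" "fconst b * p \<in> N" using stable_subspaceD(3)[OF N that] by auto
      then show "p * gx ^ l \<in> N" "p * gy ^ l \<in> N"
        using cong_mult_left[OF a, of p] cong_mult_left[OF b, of p] stable_subspace_cong[OF N]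
        by (simp_all add: fconst_commute)
    qed
    then have "stable_subspace (gx ^ l) (gy ^ l) N" using N by (simp add: stable_subspace_def)
    then show ?thesis using B by (rule basic_monomials_span)
  qed
  \<comment> \<open>The second of the two commuting operators is taken to be the identity.\<close>
  have "gg * 1 \<approx> 1 * gg" by simp
  from finitely_generated_unreachable[OF finite_basic_monomials this span]
  obtain c e where e: "\<And>p. p * (gg - fconst c) - e \<notin> J" by metis
  \<comment> \<open>g^l - c^l = h(g) (g - c), so its image lies in that of g - c and misses e as
    well; being central, it must vanish.\<close>
  have "poly (monom 1 l - [:c ^ l:]) c = 0" by (simp add: poly_monom)
  then have "[:-c, 1:] dvd monom 1 l - [:c ^ l:]" by (simp only: poly_eq_0_iff_dvd)
  then obtain h where h: "monom 1 l - [:c ^ l:] = [:-c, 1:] * h" by (elim dvdE)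
  have "gg ^ l = eval_univ gg ([:c ^ l:] + [:-c, 1:] * h)"
    by (simp only: flip: h) (simp add: eval_univ_monom)
  also have "\<dots> = fconst (c ^ l) + eval_univ gg h * (gg - fconst c)"
    by (simp only: eval_univ_add eval_univ_linear_mult) simp
  finally have eq: "gg ^ l - fconst (c ^ l) = eval_univ gg h * (gg - fconst c)" by simp
  have "p * (gg ^ l - fconst (c ^ l)) - e \<notin> J" for p
    using e[of "p * eval_univ gg h"] by (simp add: eq mult.assoc)
  moreover have "r * (gg ^ l - fconst (c ^ l)) \<approx> (gg ^ l - fconst (c ^ l)) * r" for r
    by (simp add: right_diff_distrib left_diff_distrib cong_diff gg_power_l_central)
  ultimately show ?thesis
    using central_mem_Ann_of_unreachable unfolding cong_def by metis
qed

text \<open>Split off a root d, so that f = (X - d) h. If s h(P) is nonzero, it is an eigenvector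
  for d; if it is zero, the argument continues with h. A nonzero constant cannot kill s, so the
  descent stops.\<close>

lemma eigenvector_of_polynomial:
  assumes "f \<noteq> 0" "s \<notin> J" "s * eval_univ P f \<in> J"
  shows "\<exists>d s'. s' \<notin> J \<and> s' * (P - fconst d) \<in> J"
  using assms
proof (induction "degree f" arbitrary: f)
  case 0
  then obtain c where f: "f = [:c:]" by (metis degree_eq_zeroE)
  with 0 have c: "f = [:c:]" "c \<noteq> 0" by auto
  have "fconst (inverse c) * (s * fconst c) \<in> J" using 0 c by (intro scale_mem) simp
  then have "s \<in> J" using c by (simp add: fconst_commute fconst_collect)
  then show ?case using 0 by blast
next
  case (Suc n)
  then obtain d where "poly f d = 0" using alg_closed_imp_poly_has_root[of f] by auto
  then obtain h where h: "f = [:-d, 1:] * h" by (auto simp: poly_eq_0_iff_dvd)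
  with Suc.prems have h0: "h \<noteq> 0" by auto
  have "degree f = Suc (degree h)" unfolding h using h0 by (subst degree_mult_eq) auto
  then have deg: "n = degree h" using Suc.hyps by simp
  have "s * eval_univ P h * (P - fconst d) \<in> J"
    using Suc.prems(3) unfolding h eval_univ_linear_mult by (simp add: mult.assoc)
  then show ?case
    using Suc.hyps(1)[OF deg h0 Suc.prems(2)] by blast
qed

lemma gg_eigenvector:
  obtains c' s where "c' \<noteq> 0" "s \<notin> J" "s * gg - fconst c' * s \<in> J"
proof -
  obtain c where c: "gg ^ l \<approx> fconst c" using gg_power_l_scalar by blast
  let ?f = "monom 1 l - [:c:]"
  have "coeff ?f l = 1" using l_gt_1 by (simp add: coeff_eq_0)
  then have "?f \<noteq> 0" by (metis coeff_0 zero_neq_one)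
  have "gg ^ l = eval_univ gg (?f + [:c:])" by (simp add: eval_univ_monom)
  then have "eval_univ gg ?f = gg ^ l - fconst c" by (simp only: eval_univ_add) simp
  then have "1 * eval_univ gg ?f \<in> J" using c by (simp add: cong_def Ann_imp_mem)
  from eigenvector_of_polynomial[OF \<open>?f \<noteq> 0\<close> one_not_mem this]
  obtain c' s where s: "s \<notin> J" "s * (gg - fconst c') \<in> J" by blast
  \<comment> \<open>Eigenvalue 0 would mean that g kills the nonzero vector s.\<close>
  have "c' \<noteq> 0" using s g_injective[of s] by auto
  then show ?thesis using that[of c' s] s by (simp add: right_diff_distrib fconst_commute)
qed

text \<open>The vector s x^k is acted on by g as t^k c', and x y is affine in g, so s x^(k+1) y = (s
  x^k)(x y) is a multiple of s x^k.\<close>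

lemma eigenvector_xpow_y:
  assumes s: "s * gg - fconst c' * s \<in> J"
  shows "s * gx ^ Suc k * gy - fconst ((t ^ Suc k * c' - \<alpha>) / (t - 1)) * (s * gx ^ k) \<in> J"
proof -
  let ?c = "t ^ Suc k / (t - 1)" and ?d = "\<alpha> / (t - 1)"
  have "s * gx ^ Suc k * gy = s * gx ^ k * (gx * gy)" by (simp add: power_Suc2 mult.assoc del: power_Suc)
  also have "\<dots> \<approx> s * gx ^ k * (fconst (t / (t - 1)) * gg - fconst ?d)"
    by (intro cong_mult_left xy_eq_gg)
  also have "\<dots> = fconst (t / (t - 1)) * (s * (gx ^ k * gg)) - fconst ?d * (s * gx ^ k)"
    by (simp only: right_diff_distrib fconst_commute fconst_left_commute[of s]
        fconst_left_commute[of "_ ^ _"] mult.assoc)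
  also have "\<dots> \<approx> fconst (t / (t - 1)) * (s * (fconst (t ^ k) * (gg * gx ^ k))) - fconst ?d * (s * gx ^ k)"
    by (intro cong_diff cong_mult_left xpow_gg cong_refl)
  also have "\<dots> = fconst ?c * (s * gg * gx ^ k) - fconst ?d * (s * gx ^ k)"
    by (simp only: fconst_left_commute[of s] fconst_collect mult.assoc) (simp add: fconst_collect)
  finally have 1: "s * gx ^ Suc k * gy - (fconst ?c * (s * gg * gx ^ k) - fconst ?d * (s * gx ^ k)) \<in> J"
    by (simp add: cong_def Ann_imp_mem)
  have 2: "fconst ?c * ((s * gg - fconst c' * s) * gx ^ k) \<in> J"
    using s by (intro scale_mem mult_mem)
  have "(t ^ Suc k * c' - \<alpha>) / (t - 1) = ?c * c' - ?d" by (simp add: diff_divide_distrib)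
  then have "s * gx ^ Suc k * gy - fconst ((t ^ Suc k * c' - \<alpha>) / (t - 1)) * (s * gx ^ k)
      = (s * gx ^ Suc k * gy - (fconst ?c * (s * gg * gx ^ k) - fconst ?d * (s * gx ^ k)))
        + fconst ?c * ((s * gg - fconst c' * s) * gx ^ k)"
    by (simp only: fconst_diff fconst_mult) (simp add: algebra_simps)
  also have "\<dots> \<in> J" using 1 2 by (rule add_mem)
  finally show ?thesis .
qed

section \<open>Basis vectors inside the quotient\<close>

lemma M6_vector:
  assumes t: "t = q ^ 2" and a: "gx ^ l \<approx> fconst (\<mu> ^ l)" and \<mu>: "\<mu> \<noteq> 0"
    and s: "s * gg - fconst c * s \<in> J"
    and p: "free_act l (M6_basis_act q \<alpha> l \<mu> c) p (bvec 1 0) = (\<lambda>i. 0)"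
  shows "s * p \<in> J"
proof -
  \<comment> \<open>The normalisation makes x act by the same factor \<mu> at every step, including
    the return from \<open>T (l - 1)\<close> to \<open>T 0\<close>, because x^l acts as
    \<mu>^l.\<close>
  define T where "T k = fconst (inverse \<mu> ^ k) * (s * gx ^ k)" for k
  have x_l: "s * gx ^ l - fconst (\<mu> ^ l) * s \<in> J"
    using cong_mult_left[OF a, of s] by (simp add: cong_def Ann_imp_mem fconst_commute)
  have q_pow: "q ^ (2 * k) = t ^ k" for k by (simp add: t power_mult)
  have l_Suc: "l = Suc (l - 1)" using l_gt_1 by simp
  have inv_l: "inverse \<mu> ^ l * \<mu> ^ l = 1" using \<mu> by (simp flip: power_mult_distrib)
  have "T k * fgen h - (\<Sum>j<l. fconst (M6_basis_act q \<alpha> l \<mu> c h k j) * T j) \<in> J"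
    if "k < l" for h k
  proof (cases h)
    case GX
    show ?thesis
    proof (cases "k = l - 1")
      case True
      have "inverse \<mu> ^ k * \<mu> ^ l = \<mu>"
        using inv_l \<mu> unfolding True by (subst (asm) l_Suc, subst l_Suc) (simp add: field_simps)
      then have "T k * gx - fconst \<mu> * T 0
          = fconst (inverse \<mu> ^ k) * (s * gx ^ l - fconst (\<mu> ^ l) * s)"
        using l_Suc unfolding True T_def
        by (simp add: right_diff_distrib fconst_collect mult.assoc flip: power_Suc2)
      also have "\<dots> \<in> J" using x_l by (rule scale_mem)
      finally show ?thesis
        using GX True l_gt_1 by (simp add: M6_basis_act_def sum_bvec)
    next
      case False
      then have "Suc k < l" using that by simp
      moreover have "\<mu> * (inverse \<mu> * inverse \<mu> ^ k) = inverse \<mu> ^ k"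
        using \<mu> by (metis mult.assoc mult_1 right_inverse)
      then have "T k * gx = fconst (\<mu> * (inverse \<mu> * inverse \<mu> ^ k)) * (s * gx ^ Suc k)"
        by (simp only: T_def mult.assoc power_Suc2)
      then have "T k * gx = fconst \<mu> * T (Suc k)"
        by (simp only: T_def fconst_collect power_Suc)
      ultimately show ?thesis
        using GX False by (simp add: M6_basis_act_def sum_bvec zero_mem)
    qed
  next
    case GY
    show ?thesis
    proof (cases k)
      case 0
      \<comment> \<open>No power of x precedes y here. As x^l is the scalar \<mu>^l, the vector s y
        is rewritten as \<mu>^(-l) s x^l y; the eigenvalue t^l c in the coefficient is then
        c.\<close>
      let ?d = "(c - \<alpha>) / (t - 1)"
      have "s * gx ^ l * gy - fconst ?d * (s * gx ^ (l - 1)) \<in> J"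
        using eigenvector_xpow_y[OF s, of "l - 1", folded l_Suc] by (simp only: t_pow_l mult_1)
      from diff_mem[OF this mult_mem[OF x_l, of gy]]
      have *: "fconst (inverse \<mu> ^ l) * (fconst (\<mu> ^ l) * (s * gy) - fconst ?d * (s * gx ^ (l - 1))) \<in> J"
        by (intro scale_mem) (simp add: algebra_simps)
      have "inverse \<mu> * ?d * inverse \<mu> ^ (l - 1) = inverse \<mu> ^ l * ?d"
        by (subst (2) l_Suc) (simp add: mult_ac)
      then have "fconst (inverse \<mu> * ?d) * T (l - 1) = fconst (inverse \<mu> ^ l * ?d) * (s * gx ^ (l - 1))"
        by (simp only: T_def fconst_collect)
      moreover have "T k * gy = fconst (inverse \<mu> ^ l * \<mu> ^ l) * (s * gy)"
        unfolding inv_l by (simp add: 0 T_def)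
      ultimately have "T k * gy - fconst (inverse \<mu> * ?d) * T (l - 1)
          = fconst (inverse \<mu> ^ l) * (fconst (\<mu> ^ l) * (s * gy) - fconst ?d * (s * gx ^ (l - 1)))"
        by (simp only: right_diff_distrib fconst_collect)
      with * show ?thesis
        using GY 0 l_gt_1 by (simp add: M6_basis_act_def sum_bvec t)
    next
      case (Suc k')
      let ?d = "(t ^ k * c - \<alpha>) / (t - 1)"
      have "fconst (inverse \<mu> ^ k) * (s * gx ^ k * gy - fconst ?d * (s * gx ^ k')) \<in> J"
        unfolding Suc by (intro scale_mem eigenvector_xpow_y[OF s])
      moreover have "fconst (inverse \<mu> ^ k) * (s * gx ^ k * gy - fconst ?d * (s * gx ^ k'))
          = T k * gy - fconst (inverse \<mu> * ?d) * T k'"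
        by (simp add: T_def right_diff_distrib fconst_collect mult.assoc Suc mult_ac)
      moreover have "M6_basis_act q \<alpha> l \<mu> c h k = bvec (inverse \<mu> * ?d) k'"
      proof -
        have k: "k \<noteq> 0" "k - 1 = k'" using Suc by auto
        show ?thesis
          by (simp only: GY M6_basis_act_def gen.case q_pow k simp_thms if_True flip: t)
      qed
      ultimately show ?thesis using Suc that GY by (simp only: sum_bvec Suc_lessD)
    qed
  next
    case GZ
    have "T k * gz \<in> J" by (intro Ann_imp_mem Ann_mult_left z_Ann)
    then show ?thesis by (simp add: GZ M6_basis_act_def)
  qed
  from free_act_lift_annihilator[OF this _ p] have "T 0 * p \<in> J" using l_gt_1 by simp
  then show ?thesis by (simp add: T_def)
qed

lemma M7_vector:
  assumes t: "t = q ^ 2" and b: "gy ^ l \<approx> fconst \<mu>" and s: "s * gx \<in> J"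
    and p: "free_act l (M7_basis_act q \<alpha> l \<mu>) p (bvec 1 0) = (\<lambda>i. 0)"
  shows "s * p \<in> J"
proof -
  define T where "T k = s * gy ^ k" for k
  have y_l: "s * gy ^ l - fconst \<mu> * s \<in> J"
    using cong_mult_left[OF b, of s] by (simp add: cong_def Ann_imp_mem fconst_commute)
  have q_pow: "q ^ (2 * k) = t ^ k" for k by (simp add: t power_mult)
  have l_Suc: "l = Suc (l - 1)" using l_gt_1 by simp
  have "T k * fgen h - (\<Sum>j<l. fconst (M7_basis_act q \<alpha> l \<mu> h k j) * T j) \<in> J"
    if "k < l" for h k
  proof (cases h)
    case GX
    show ?thesis
    proof (cases "k = 0")
      case True
      have "T k * gx \<in> J" using s True by (simp add: T_def)
      then show ?thesis using GX True by (simp add: M7_basis_act_def)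
    next
      case False
      \<comment> \<open>Up to sign this is the M_7 coefficient: the correction term of
        \<open>ypow_x\<close>. The other term of that rule begins with s x and vanishes.\<close>
      let ?d = "inverse (t ^ k) * (\<alpha> * qsum k)"
      have coeff: "inverse t * \<alpha> * (1 - inverse (t ^ k)) / (1 - inverse t) = ?d"
        using t_nz t_ne_1 by (simp add: qsum_eq field_simps)
      have "T k * gx \<approx> s * (fconst (inverse (t ^ k)) * (gx * gy ^ k) - fconst ?d * gy ^ (k - 1))"
        unfolding T_def mult.assoc by (intro cong_mult_left ypow_x)
      also have "\<dots> = fconst (inverse (t ^ k)) * (s * gx * gy ^ k) - fconst ?d * T (k - 1)"
        by (simp only: right_diff_distrib fconst_left_commute[of s] T_def mult.assoc)
      finally have "T k * gx - (fconst (inverse (t ^ k)) * (s * gx * gy ^ k) - fconst ?d * T (k - 1)) \<in> J"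
        by (simp add: cong_def Ann_imp_mem)
      moreover have "fconst (inverse (t ^ k)) * (s * gx * gy ^ k) \<in> J"
        by (intro scale_mem mult_mem[OF s])
      ultimately have "T k * gx + fconst ?d * T (k - 1) \<in> J" using add_mem by fastforce
      then show ?thesis
        using GX False that
        by (simp add: M7_basis_act_def sum_bvec q_pow flip: t del: mult_minus_left)
          (simp add: coeff fconst_minus)
    qed
  next
    case GY
    show ?thesis
    proof (cases "k = l - 1")
      case True
      have "Suc k = l" using True l_gt_1 by simp
      then have "gy ^ k * gy = gy ^ l" by (simp only: flip: power_Suc2)
      then have "T k * gy - fconst \<mu> * T 0 = s * gy ^ l - fconst \<mu> * s"
        by (simp add: T_def mult.assoc)
      then show ?thesis using GY True y_l l_gt_1 by (simp add: M7_basis_act_def sum_bvec)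
    next
      case False
      then have "Suc k < l" using that by simp
      then show ?thesis
        using GY False by (simp add: M7_basis_act_def sum_bvec zero_mem T_def mult.assoc power_commutes)
    qed
  next
    case GZ
    have "T k * gz \<in> J" by (intro Ann_imp_mem Ann_mult_left z_Ann)
    then show ?thesis by (simp add: GZ M7_basis_act_def)
  qed
  from free_act_lift_annihilator[OF this _ p] have "T 0 * p \<in> J" using l_gt_1 by simp
  then show ?thesis by (simp add: T_def)
qed

lemma M6_or_M7_vector:
  assumes t: "t = q ^ 2"
  shows "(\<exists>\<mu>\<^sub>1 \<mu>\<^sub>2 s. \<mu>\<^sub>1 \<noteq> 0 \<and> \<mu>\<^sub>2 \<noteq> 0 \<and> s \<notin> J \<and>
      (\<forall>p. free_act l (M6_basis_act q \<alpha> l \<mu>\<^sub>1 \<mu>\<^sub>2) p (bvec 1 0) = (\<lambda>i. 0) \<longrightarrow> s * p \<in> J)) \<or>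
    (\<exists>\<mu> s. s \<notin> J \<and>
      (\<forall>p. free_act l (M7_basis_act q \<alpha> l \<mu>) p (bvec 1 0) = (\<lambda>i. 0) \<longrightarrow> s * p \<in> J))"
proof -
  obtain a where a: "gx ^ l \<approx> fconst a" using x_power_l_scalar by blast
  show ?thesis
  proof (cases "a = 0")
    case False
    obtain \<mu> where \<mu>: "\<mu> ^ l = a" using nth_root_exists[of l a] l_gt_1 by auto
    with False have "\<mu> \<noteq> 0" using l_gt_1 by (auto simp: power_0_left)
    moreover obtain c s where "c \<noteq> 0" "s \<notin> J" "s * gg - fconst c * s \<in> J"
      using gg_eigenvector by blast
    ultimately show ?thesis using M6_vector[OF t, of \<mu> s c] a \<mu> by blast
  next
    case True
    then have "gx ^ l \<in> J" using a by (simp add: cong_0_iff Ann_imp_mem)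
    \<comment> \<open>The last nonzero power of x is the vector killed by x.\<close>
    then obtain m where "gx ^ m \<notin> J" "gx ^ m * gx \<in> J"
      using last_power_not_mem by (metis power_Suc2)
    moreover obtain b where "gy ^ l \<approx> fconst b" using y_power_l_scalar by blast
    ultimately show ?thesis using M7_vector[OF t, of b "gx ^ m"] by blast
  qed
qed

end

section \<open>Right modules over the quotient algebra\<close>

lemma free_ring_simps [simp]:
  "carrier free_ring = (UNIV :: 'k::field free_alg set)" "p \<otimes>\<^bsub>free_ring\<^esub> r = p * (r :: 'k free_alg)"
  "p \<oplus>\<^bsub>free_ring\<^esub> r = p + (r :: 'k free_alg)" "\<one>\<^bsub>free_ring\<^esub> = (1 :: 'k free_alg)"
  "\<zero>\<^bsub>free_ring\<^esub> = (0 :: 'k free_alg)"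
  by (simp_all add: ring_of_type_algebra_def)

lemma ring_free_ring: "ring (free_ring :: 'k::field free_alg ring)"
proof -
  have "\<exists>r. p + r = 0" for p :: "'k free_alg" by (metis add.right_inverse)
  then show ?thesis
    unfolding ring_of_type_algebra_def using add.right_inverse
    by unfold_locales (auto simp: algebra_simps Units_def)
qed

lemma free_ring_minus [simp]: "\<ominus>\<^bsub>free_ring\<^esub> p = - (p :: 'k::field free_alg)"
proof -
  interpret ring "free_ring :: 'k free_alg ring" by (rule ring_free_ring)
  show ?thesis by (rule minus_equality) simp_all
qed

lemma ideal_A_ideal: "ideal (A_ideal q \<alpha>) free_ring"
  unfolding A_ideal_def by (rule ring.genideal_ideal[OF ring_free_ring]) simp

lemma A_ideal_minimal:
  assumes "A_relators q \<alpha> \<subseteq> I" "0 \<in> I" "\<And>p r. p \<in> I \<Longrightarrow> r \<in> I \<Longrightarrow> p + r \<in> I"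
    and "\<And>p r. p \<in> I \<Longrightarrow> r * p \<in> I" "\<And>p r. p \<in> I \<Longrightarrow> p * r \<in> I"
  shows "A_ideal q \<alpha> \<subseteq> I"
  unfolding A_ideal_def
proof (rule ring.genideal_minimal[OF ring_free_ring _ assms(1)], rule idealI[OF ring_free_ring])
  interpret ring "free_ring :: 'a free_alg ring" by (rule ring_free_ring)
  have "- p \<in> I" if "p \<in> I" for p using assms(4)[OF that, of "-1"] by simp
  then show "subgroup I (add_monoid (free_ring :: 'a free_alg ring))"
    using assms by (intro add.subgroupI) (auto simp flip: a_inv_def)
qed (use assms in auto)

lemma A_relators_subset: "A_relators q \<alpha> \<subseteq> A_ideal q \<alpha>"
  unfolding A_ideal_def by (rule ring.genideal_self[OF ring_free_ring]) simp

definition A_class :: "'k::field \<Rightarrow> 'k \<Rightarrow> 'k free_alg \<Rightarrow> 'k free_alg set" where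
  "A_class q \<alpha> p = A_ideal q \<alpha> +>\<^bsub>free_ring\<^esub> p"

lemma A_class_hom: "ring_hom_ring free_ring (A_alg q \<alpha>) (A_class q \<alpha>)"
  unfolding A_alg_def A_class_def[abs_def] by (rule ideal.rcos_ring_hom_ring[OF ideal_A_ideal])

lemma ring_A_alg: "ring (A_alg q \<alpha>)"
  unfolding A_alg_def by (rule ideal.quotient_is_ring[OF ideal_A_ideal])

lemma carrier_A_alg: "carrier (A_alg q \<alpha>) = range (A_class q \<alpha>)"
  by (auto simp: A_alg_def A_class_def FactRing_def A_RCOSETS_def')

lemma mem_A_class_iff: "r \<in> A_class q \<alpha> p \<longleftrightarrow> r - p \<in> A_ideal q \<alpha>"
proof -
  have "r \<in> A_class q \<alpha> p \<longleftrightarrow> (\<exists>h\<in>A_ideal q \<alpha>. r = h + p)"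
    by (simp add: A_class_def a_r_coset_def')
  also have "\<dots> \<longleftrightarrow> r - p \<in> A_ideal q \<alpha>" by (metis add_diff_cancel diff_add_cancel)
  finally show ?thesis .
qed

lemma zero_mem_A_ideal: "0 \<in> A_ideal q \<alpha>"
  using additive_subgroup.zero_closed[OF ideal.axioms(1)[OF ideal_A_ideal]] by simp

lemma self_mem_A_class: "p \<in> A_class q \<alpha> p"
  by (simp add: mem_A_class_iff zero_mem_A_ideal)

lemma A_class_mem [simp]: "A_class q \<alpha> p \<in> carrier (A_alg q \<alpha>)"
  by (simp add: carrier_A_alg)

lemma A_class_mult: "A_class q \<alpha> (p * r) = A_class q \<alpha> p \<otimes>\<^bsub>A_alg q \<alpha>\<^esub> A_class q \<alpha> r"
  and A_class_add: "A_class q \<alpha> (p + r) = A_class q \<alpha> p \<oplus>\<^bsub>A_alg q \<alpha>\<^esub> A_class q \<alpha> r"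
  and A_class_one: "A_class q \<alpha> 1 = \<one>\<^bsub>A_alg q \<alpha>\<^esub>"
  and A_class_zero: "A_class q \<alpha> 0 = \<zero>\<^bsub>A_alg q \<alpha>\<^esub>"
  and A_class_minus: "A_class q \<alpha> (- p) = \<ominus>\<^bsub>A_alg q \<alpha>\<^esub> A_class q \<alpha> p"
proof -
  interpret ring_hom_ring free_ring "A_alg q \<alpha>" "A_class q \<alpha>" by (rule A_class_hom)
  show "A_class q \<alpha> (p * r) = A_class q \<alpha> p \<otimes>\<^bsub>A_alg q \<alpha>\<^esub> A_class q \<alpha> r" using hom_mult[of p r] by simp
  show "A_class q \<alpha> (p + r) = A_class q \<alpha> p \<oplus>\<^bsub>A_alg q \<alpha>\<^esub> A_class q \<alpha> r" using hom_add[of p r] by simp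
  show "A_class q \<alpha> 1 = \<one>\<^bsub>A_alg q \<alpha>\<^esub>" using hom_one by simp
  show "A_class q \<alpha> 0 = \<zero>\<^bsub>A_alg q \<alpha>\<^esub>" using hom_zero by simp
  show "A_class q \<alpha> (- p) = \<ominus>\<^bsub>A_alg q \<alpha>\<^esub> A_class q \<alpha> p" using hom_a_inv[of p] by simp
qed

lemma A_gen_eq: "A_gen q \<alpha> g = A_class q \<alpha> (fgen g)"
  by (simp add: A_gen_def A_class_def)

lemma A_g_eq: "A_g q \<alpha> = A_class q \<alpha> (fgen GX * fgen GY - fgen GY * fgen GX)"
proof -
  have "fgen GX * fgen GY - fgen GY * fgen GX = fgen GX * fgen GY + - (fgen GY * fgen GX :: 'a free_alg)"
    by simp
  then show ?thesis
    by (simp only: A_g_def A_gen_eq a_minus_def A_class_mult A_class_add A_class_minus)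
qed

lemma A_class_eq_zero:
  assumes "p \<in> A_ideal q \<alpha>"
  shows "A_class q \<alpha> p = \<zero>\<^bsub>A_alg q \<alpha>\<^esub>"
proof -
  interpret ideal "A_ideal q \<alpha>" free_ring by (rule ideal_A_ideal)
  show ?thesis using a_rcos_const[OF assms] by (simp add: A_class_def A_alg_def FactRing_def)
qed

section \<open>Cyclic vectors and isomorphisms of simple right modules\<close>

context right_module
begin

lemma act_zero_module [simp]: "a \<in> carrier R \<Longrightarrow> a \<odot>\<^bsub>M\<^esub> \<zero>\<^bsub>M\<^esub> = \<zero>\<^bsub>M\<^esub>"
  using act_distrib_module[of a "\<zero>\<^bsub>M\<^esub>" "\<zero>\<^bsub>M\<^esub>"] act_closed[of a "\<zero>\<^bsub>M\<^esub>"]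
  by (metis M.add.l_cancel M.add.r_cancel_one M.zero_closed M.l_zero)

lemma act_zero_ring [simp]: "m \<in> carrier M \<Longrightarrow> \<zero> \<odot>\<^bsub>M\<^esub> m = \<zero>\<^bsub>M\<^esub>"
  using act_distrib_ring[of "\<zero>" "\<zero>" m] act_closed[of "\<zero>" m]
  by (metis M.add.r_cancel_one R.zero_closed R.l_zero)

lemma act_minus:
  assumes "a \<in> carrier R" "m \<in> carrier M"
  shows "(\<ominus> a) \<odot>\<^bsub>M\<^esub> m = \<ominus>\<^bsub>M\<^esub> (a \<odot>\<^bsub>M\<^esub> m)"
proof -
  have "(\<ominus> a) \<odot>\<^bsub>M\<^esub> m \<oplus>\<^bsub>M\<^esub> a \<odot>\<^bsub>M\<^esub> m = (\<ominus> a \<oplus> a) \<odot>\<^bsub>M\<^esub> m"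
    using assms by (simp add: act_distrib_ring)
  also have "\<dots> = \<zero>\<^bsub>M\<^esub>" using assms by (simp add: R.l_neg)
  finally show ?thesis using assms act_closed by (intro M.minus_equality[symmetric]) auto
qed

lemma sub_eq_zero_iff:
  assumes "m \<in> carrier M" "n \<in> carrier M"
  shows "m \<ominus>\<^bsub>M\<^esub> n = \<zero>\<^bsub>M\<^esub> \<longleftrightarrow> m = n"
proof
  assume "m \<ominus>\<^bsub>M\<^esub> n = \<zero>\<^bsub>M\<^esub>"
  then have "\<ominus>\<^bsub>M\<^esub> (\<ominus>\<^bsub>M\<^esub> n) = m"
    using assms by (intro M.minus_equality) (auto simp: a_minus_def)
  then show "m = n" using assms by simp
qed (use assms in \<open>simp add: a_minus_def M.r_neg\<close>)

lemma right_submoduleI: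
  assumes "N \<subseteq> carrier M" "N \<noteq> {}"
    and add: "\<And>m n. m \<in> N \<Longrightarrow> n \<in> N \<Longrightarrow> m \<oplus>\<^bsub>M\<^esub> n \<in> N"
    and act: "\<And>a m. a \<in> carrier R \<Longrightarrow> m \<in> N \<Longrightarrow> a \<odot>\<^bsub>M\<^esub> m \<in> N"
  shows "submodule N R M"
proof (intro submodule.intro submodule_axioms.intro act)
  have "\<ominus>\<^bsub>M\<^esub> m \<in> N" if "m \<in> N" for m
    using act[of "\<ominus> \<one>" m] act_minus[of \<one> m] assms(1) that act_one[of m] by auto
  then show "subgroup N (add_monoid M)"
    using assms by (intro M.add.subgroupI) (auto simp flip: a_inv_def)
qed

definition orbit :: "'m \<Rightarrow> 'm set" where
  "orbit v = (\<lambda>a. a \<odot>\<^bsub>M\<^esub> v) ` carrier R"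

lemma orbit_submodule:
  assumes "v \<in> carrier M"
  shows "submodule (orbit v) R M"
proof (rule right_submoduleI)
  show "orbit v \<subseteq> carrier M" using assms act_closed by (auto simp: orbit_def)
  show "orbit v \<noteq> {}" by (auto simp: orbit_def)
next
  fix m n assume "m \<in> orbit v" "n \<in> orbit v"
  then obtain a b where "a \<in> carrier R" "b \<in> carrier R" "m = a \<odot>\<^bsub>M\<^esub> v" "n = b \<odot>\<^bsub>M\<^esub> v"
    by (auto simp: orbit_def)
  then show "m \<oplus>\<^bsub>M\<^esub> n \<in> orbit v"
    using assms by (auto simp: orbit_def image_iff intro!: bexI[of _ "a \<oplus> b"] act_distrib_ring[symmetric])
next
  fix b m assume "b \<in> carrier R" "m \<in> orbit v"
  then obtain a where "a \<in> carrier R" "m = a \<odot>\<^bsub>M\<^esub> v" by (auto simp: orbit_def)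
  then show "b \<odot>\<^bsub>M\<^esub> m \<in> orbit v"
    using assms \<open>b \<in> carrier R\<close>
    by (auto simp: orbit_def image_iff intro!: bexI[of _ "a \<otimes> b"] act_mult[symmetric])
qed

lemma mem_orbit: "v \<in> carrier M \<Longrightarrow> v \<in> orbit v"
  using act_one[of v] by (force simp: orbit_def)

end

lemma simple_right_module_cyclic:
  assumes "simple_right_module R M" and v: "v \<in> carrier M" "v \<noteq> \<zero>\<^bsub>M\<^esub>" and m: "m \<in> carrier M"
  obtains a where "a \<in> carrier R" "m = a \<odot>\<^bsub>M\<^esub> v"
proof -
  interpret right_module R M using assms by (simp add: simple_right_module_def)
  have "orbit v = carrier M"
    using orbit_submodule[OF v(1)] mem_orbit[OF v(1)] assms v by (auto simp: simple_right_module_def)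
  then show ?thesis using that m by (auto simp: orbit_def)
qed

text \<open>Both vectors generate, so the isomorphism must send v a to w a; this is well defined and
  injective once the two annihilators agree. The assumed inclusion suffices because the annihilator
  of w is a maximal right ideal.\<close>

lemma simple_right_module_iso_of_annihilator:
  assumes M: "simple_right_module R M" and N: "simple_right_module R N"
    and v: "v \<in> carrier M" "v \<noteq> \<zero>\<^bsub>M\<^esub>" and w: "w \<in> carrier N" "w \<noteq> \<zero>\<^bsub>N\<^esub>"
    and ann: "\<And>a. a \<in> carrier R \<Longrightarrow> a \<odot>\<^bsub>N\<^esub> w = \<zero>\<^bsub>N\<^esub> \<Longrightarrow> a \<odot>\<^bsub>M\<^esub> v = \<zero>\<^bsub>M\<^esub>"
  shows "right_module_iso R M N"
proof -
  interpret M: right_module R M using M by (simp add: simple_right_module_def)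
  interpret N: right_module R N using N by (simp add: simple_right_module_def)
  have diff: "a \<ominus>\<^bsub>R\<^esub> b \<in> carrier R" "(a \<ominus>\<^bsub>R\<^esub> b) \<odot>\<^bsub>M\<^esub> v = a \<odot>\<^bsub>M\<^esub> v \<ominus>\<^bsub>M\<^esub> b \<odot>\<^bsub>M\<^esub> v"
    "(a \<ominus>\<^bsub>R\<^esub> b) \<odot>\<^bsub>N\<^esub> w = a \<odot>\<^bsub>N\<^esub> w \<ominus>\<^bsub>N\<^esub> b \<odot>\<^bsub>N\<^esub> w"
    if "a \<in> carrier R" "b \<in> carrier R" for a b
    using that v w by (simp_all add: a_minus_def M.act_distrib_ring N.act_distrib_ring M.act_minus N.act_minus)
  \<comment> \<open>If a kills v but not w, choose b with w a b = w. Then a b - 1 kills w, hence v;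
    but a b kills v too, so v = 0.\<close>
  have ann': "a \<odot>\<^bsub>N\<^esub> w = \<zero>\<^bsub>N\<^esub>" if a: "a \<in> carrier R" "a \<odot>\<^bsub>M\<^esub> v = \<zero>\<^bsub>M\<^esub>" for a
  proof (rule ccontr)
    assume "a \<odot>\<^bsub>N\<^esub> w \<noteq> \<zero>\<^bsub>N\<^esub>"
    then obtain b where b: "b \<in> carrier R" "w = b \<odot>\<^bsub>N\<^esub> (a \<odot>\<^bsub>N\<^esub> w)"
      using simple_right_module_cyclic[OF N N.act_closed[OF a(1) w(1)] _ w(1)] by blast
    then have "(a \<otimes>\<^bsub>R\<^esub> b) \<odot>\<^bsub>N\<^esub> w = w" using a w by (simp add: N.act_mult)
    then have "(a \<otimes>\<^bsub>R\<^esub> b \<ominus>\<^bsub>R\<^esub> \<one>\<^bsub>R\<^esub>) \<odot>\<^bsub>N\<^esub> w = \<zero>\<^bsub>N\<^esub>"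
      using diff(3)[of "a \<otimes>\<^bsub>R\<^esub> b" "\<one>\<^bsub>R\<^esub>"] a b w by (simp add: N.act_one N.sub_eq_zero_iff)
    then have "(a \<otimes>\<^bsub>R\<^esub> b \<ominus>\<^bsub>R\<^esub> \<one>\<^bsub>R\<^esub>) \<odot>\<^bsub>M\<^esub> v = \<zero>\<^bsub>M\<^esub>"
      using a b by (intro ann) auto
    then have "\<zero>\<^bsub>M\<^esub> \<ominus>\<^bsub>M\<^esub> v = \<zero>\<^bsub>M\<^esub>" using a b v by (simp add: diff M.act_mult M.act_one)
    then have "v = \<zero>\<^bsub>M\<^esub>" using v by (metis M.sub_eq_zero_iff M.zero_closed)
    then show False using v by simp
  qed
  have eq_iff: "a \<odot>\<^bsub>M\<^esub> v = b \<odot>\<^bsub>M\<^esub> v \<longleftrightarrow> a \<odot>\<^bsub>N\<^esub> w = b \<odot>\<^bsub>N\<^esub> w"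
    if "a \<in> carrier R" "b \<in> carrier R" for a b
    using that v w ann[of "a \<ominus>\<^bsub>R\<^esub> b"] ann'[of "a \<ominus>\<^bsub>R\<^esub> b"] diff[OF that]
      M.act_closed[OF that(1) v(1)] M.act_closed[OF that(2) v(1)]
      N.act_closed[OF that(1) w(1)] N.act_closed[OF that(2) w(1)]
    by (metis M.sub_eq_zero_iff N.sub_eq_zero_iff)
  define \<phi> where "\<phi> m = (SOME a. a \<in> carrier R \<and> m = a \<odot>\<^bsub>M\<^esub> v) \<odot>\<^bsub>N\<^esub> w" for m
  have \<phi>: "\<phi> (a \<odot>\<^bsub>M\<^esub> v) = a \<odot>\<^bsub>N\<^esub> w" if a: "a \<in> carrier R" for a
  proof -
    let ?b = "SOME b. b \<in> carrier R \<and> a \<odot>\<^bsub>M\<^esub> v = b \<odot>\<^bsub>M\<^esub> v"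
    have "?b \<in> carrier R \<and> a \<odot>\<^bsub>M\<^esub> v = ?b \<odot>\<^bsub>M\<^esub> v"
      using a by (intro someI[of "\<lambda>b. b \<in> carrier R \<and> a \<odot>\<^bsub>M\<^esub> v = b \<odot>\<^bsub>M\<^esub> v" a]) simp
    then show ?thesis using eq_iff[OF a, of ?b] by (simp add: \<phi>_def)
  qed
  note cyc = simple_right_module_cyclic[OF M v] and cyc' = simple_right_module_cyclic[OF N w]
  show ?thesis
    unfolding right_module_iso_def
  proof (intro exI conjI ballI)
    show "bij_betw \<phi> (carrier M) (carrier N)"
      unfolding bij_betw_def
    proof
      show "inj_on \<phi> (carrier M)"
        by (rule inj_onI) (metis cyc \<phi> eq_iff)
      show "\<phi> ` carrier M = carrier N"
      proof
        show "\<phi> ` carrier M \<subseteq> carrier N"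
        proof
          fix n assume "n \<in> \<phi> ` carrier M"
          then obtain m where "m \<in> carrier M" "n = \<phi> m" by blast
          then obtain a where "a \<in> carrier R" "n = \<phi> (a \<odot>\<^bsub>M\<^esub> v)" using cyc by metis
          then show "n \<in> carrier N" using \<phi> w N.act_closed by simp
        qed
        show "carrier N \<subseteq> \<phi> ` carrier M"
        proof
          fix n assume "n \<in> carrier N"
          then obtain a where "a \<in> carrier R" "n = a \<odot>\<^bsub>N\<^esub> w" using cyc' by blast
          then show "n \<in> \<phi> ` carrier M" using \<phi> M.act_closed v by (metis imageI)
        qed
      qed
    qed
  next
    fix m n assume "m \<in> carrier M" "n \<in> carrier M"
    then obtain a b where ab: "a \<in> carrier R" "b \<in> carrier R" "m = a \<odot>\<^bsub>M\<^esub> v" "n = b \<odot>\<^bsub>M\<^esub> v"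
      using cyc by metis
    then have "m \<oplus>\<^bsub>M\<^esub> n = (a \<oplus>\<^bsub>R\<^esub> b) \<odot>\<^bsub>M\<^esub> v" using v by (simp add: M.act_distrib_ring)
    then show "\<phi> (m \<oplus>\<^bsub>M\<^esub> n) = \<phi> m \<oplus>\<^bsub>N\<^esub> \<phi> n"
      using ab \<phi> w by (simp add: N.act_distrib_ring)
  next
    fix b m assume b: "b \<in> carrier R" and "m \<in> carrier M"
    then obtain a where a: "a \<in> carrier R" "m = a \<odot>\<^bsub>M\<^esub> v" using cyc by metis
    then have "b \<odot>\<^bsub>M\<^esub> m = (a \<otimes>\<^bsub>R\<^esub> b) \<odot>\<^bsub>M\<^esub> v" using v b by (simp add: M.act_mult)
    then show "\<phi> (b \<odot>\<^bsub>M\<^esub> m) = b \<odot>\<^bsub>N\<^esub> \<phi> m"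
      using a b \<phi> w by (simp add: N.act_mult)
  qed
qed

lemma annihilator_quantum_right_ideal:
  fixes q \<alpha> :: "'k::alg_closed_field" and M :: "('k free_alg set, 'm) module"
  assumes q: "is_primitive_root_of_unity l (q ^ 2)" "l > 1"
    and M: "simple_right_module (A_alg q \<alpha>) M"
    and z: "acts_nilpotently M (A_gen q \<alpha> GZ)" and g: "acts_invertibly M (A_g q \<alpha>)"
    and v: "v \<in> carrier M" "v \<noteq> \<zero>\<^bsub>M\<^esub>"
  shows "quantum_right_ideal {p. A_class q \<alpha> p \<odot>\<^bsub>M\<^esub> v = \<zero>\<^bsub>M\<^esub>} (q ^ 2) \<alpha> l"
proof -
  let ?c = "A_class q \<alpha>"
  define J where "J = {p. ?c p \<odot>\<^bsub>M\<^esub> v = \<zero>\<^bsub>M\<^esub>}"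
  interpret right_module "A_alg q \<alpha>" M using M by (simp add: simple_right_module_def)
  have act_mem: "?c p \<odot>\<^bsub>M\<^esub> v \<in> carrier M" for p using v by (simp add: act_closed)
  have act_times: "?c (p * r) \<odot>\<^bsub>M\<^esub> v = ?c r \<odot>\<^bsub>M\<^esub> (?c p \<odot>\<^bsub>M\<^esub> v)" for p r
    using v by (simp add: A_class_mult act_mult)
  have act_plus: "?c (p + r) \<odot>\<^bsub>M\<^esub> v = ?c p \<odot>\<^bsub>M\<^esub> v \<oplus>\<^bsub>M\<^esub> ?c r \<odot>\<^bsub>M\<^esub> v" for p r
    using v by (simp add: A_class_add act_distrib_ring)
  have act_1: "?c 1 \<odot>\<^bsub>M\<^esub> v = v" using v by (simp add: A_class_one act_one)
  have act_diff: "?c (p - r) \<odot>\<^bsub>M\<^esub> v = \<zero>\<^bsub>M\<^esub>" if "?c p \<odot>\<^bsub>M\<^esub> v = ?c r \<odot>\<^bsub>M\<^esub> v" for p r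
  proof -
    have "?c p \<odot>\<^bsub>M\<^esub> v = ?c (p - r) \<odot>\<^bsub>M\<^esub> v \<oplus>\<^bsub>M\<^esub> ?c r \<odot>\<^bsub>M\<^esub> v" using act_plus[of "p - r" r] by simp
    then show ?thesis using that act_mem by (metis M.add.r_cancel_one')
  qed
  have "maximal_right_ideal J"
  proof
    show "0 \<in> J" using v by (simp add: J_def A_class_zero)
    show "p + r \<in> J" if "p \<in> J" "r \<in> J" for p r using that by (simp add: J_def act_plus)
    show "p * r \<in> J" if "p \<in> J" for p r using that by (simp add: J_def act_times)
    show "1 \<notin> J" using v by (simp add: J_def act_1)
    show "\<exists>r. p * r - 1 \<in> J" if "p \<notin> J" for p
    proof -
      have "?c p \<odot>\<^bsub>M\<^esub> v \<noteq> \<zero>\<^bsub>M\<^esub>" using that by (simp add: J_def)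
      from simple_right_module_cyclic[OF M act_mem this v(1)]
      obtain r where "v = ?c r \<odot>\<^bsub>M\<^esub> (?c p \<odot>\<^bsub>M\<^esub> v)" unfolding carrier_A_alg by blast
      then have "?c (p * r - 1) \<odot>\<^bsub>M\<^esub> v = \<zero>\<^bsub>M\<^esub>" by (intro act_diff) (simp add: act_times act_1)
      then show ?thesis by (auto simp: J_def)
    qed
  qed
  then interpret J: alg_closed_maximal_right_ideal J by (rule alg_closed_maximal_right_ideal.intro)
  \<comment> \<open>Ideal elements have class zero, so they kill every vector v s; the defining
    relations thereby become congruences modulo \<open>Ann\<close>.\<close>
  have "A_ideal q \<alpha> \<subseteq> J.Ann"
  proof
    fix r assume "r \<in> A_ideal q \<alpha>"
    then have "?c (s * r) \<odot>\<^bsub>M\<^esub> v = \<zero>\<^bsub>M\<^esub>" for s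
      using act_mem by (simp add: act_times A_class_eq_zero)
    then show "r \<in> J.Ann" unfolding J.Ann_def by (simp add: J_def)
  qed
  then have rel: "A_relators q \<alpha> \<subseteq> J.Ann" using A_relators_subset by blast
  have "quantum_right_ideal J (q ^ 2) \<alpha> l"
  proof
    show "\<exists>n. fgen GZ ^ n \<in> J"
    proof -
      have pow: "((\<lambda>u. ?c (fgen GZ) \<odot>\<^bsub>M\<^esub> u) ^^ n) v = ?c (fgen GZ ^ n) \<odot>\<^bsub>M\<^esub> v" for n
        by (induction n) (simp_all add: act_1 act_times power_Suc2 del: power_Suc)
      obtain n where "((\<lambda>u. ?c (fgen GZ) \<odot>\<^bsub>M\<^esub> u) ^^ n) v = \<zero>\<^bsub>M\<^esub>"
        using z v by (auto simp: acts_nilpotently_def A_gen_eq)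
      then show ?thesis by (auto simp: J_def pow)
    qed
    show "p \<in> J" if "p * (fgen GX * fgen GY - fgen GY * fgen GX) \<in> J" for p
    proof -
      let ?g = "?c (fgen GX * fgen GY - fgen GY * fgen GX)"
      have "inj_on (\<lambda>m. ?g \<odot>\<^bsub>M\<^esub> m) (carrier M)"
        using g by (simp add: acts_invertibly_def A_g_eq bij_betw_def)
      moreover have "?g \<odot>\<^bsub>M\<^esub> (?c p \<odot>\<^bsub>M\<^esub> v) = ?g \<odot>\<^bsub>M\<^esub> \<zero>\<^bsub>M\<^esub>"
        using that by (simp add: J_def act_times)
      ultimately have "?c p \<odot>\<^bsub>M\<^esub> v = \<zero>\<^bsub>M\<^esub>"
        using act_mem by (meson M.zero_closed inj_onD)
      then show ?thesis by (simp add: J_def)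
    qed
  qed (use q rel in \<open>simp_all add: J.cong_def A_relators_def\<close>)
  then show ?thesis by (simp only: J_def)
qed

section \<open>Modules given by a table\<close>

lemma free_act_superset:
  assumes "finite A" "Poly_Mapping.keys p \<subseteq> A"
  shows "free_act l b p v = (\<lambda>i. \<Sum>w\<in>A.
    Poly_Mapping.lookup p w * fold (\<lambda>g. lin_ext l (b g)) (letters w) v i)"
  unfolding free_act_def
  by (intro ext sum.mono_neutral_left) (use assms in \<open>auto simp: in_keys_iff\<close>)

lemma free_act_0 [simp]: "free_act l b 0 v = (\<lambda>i. 0)"
  by (simp add: free_act_def)

lemma free_act_add: "free_act l b (p + r) v = (\<lambda>i. free_act l b p v i + free_act l b r v i)"
proof -
  let ?A = "Poly_Mapping.keys p \<union> Poly_Mapping.keys r"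
  have "finite ?A" "Poly_Mapping.keys (p + r) \<subseteq> ?A" by (simp_all add: keys_add)
  then show ?thesis
    by (simp add: free_act_superset[of ?A] lookup_add distrib_right sum.distrib)
qed

lemma lookup_fconst_mult: "Poly_Mapping.lookup (fconst c * p) w = c * Poly_Mapping.lookup p w"
  by (simp add: fconst_def Poly_Mapping.map.rep_eq when_def flip: mult_map_scale_conv_mult)

lemma free_act_scale: "free_act l b (fconst c * p) v = (\<lambda>i. c * free_act l b p v i)"
proof -
  have "Poly_Mapping.keys (fconst c * p) \<subseteq> Poly_Mapping.keys p"
    by (auto simp: in_keys_iff lookup_fconst_mult)
  then show ?thesis
    by (simp add: free_act_superset[of "Poly_Mapping.keys p"] lookup_fconst_mult sum_distrib_left mult.assoc)
qed

lemma free_act_diff: "free_act l b (p - r) v = (\<lambda>i. free_act l b p v i - free_act l b r v i)"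
  using free_act_add[of l b p "- r" v] free_act_scale[of l b "-1" r v] by (simp add: fconst_minus)

lemma free_act_fword: "free_act l b (fword ws) v = fold (\<lambda>g. lin_ext l (b g)) ws v"
  by (simp add: free_act_def fword_def)

lemma free_act_1 [simp]: "free_act l b 1 v = v"
  using free_act_fword[of l b "[]" v] by simp

lemma free_act_fgen: "free_act l b (fgen g) v = lin_ext l (b g) v"
  using free_act_fword[of l b "[g]" v] by (simp add: fword_Cons)

lemma fold_lin_ext_add:
  "fold (\<lambda>g. lin_ext l (b g)) ws (\<lambda>i. u i + v i)
    = (\<lambda>i. fold (\<lambda>g. lin_ext l (b g)) ws u i + fold (\<lambda>g. lin_ext l (b g)) ws v i)"
proof (induction ws arbitrary: u v)
  case (Cons g ws)
  have "lin_ext l (b g) (\<lambda>i. u i + v i) = (\<lambda>i. lin_ext l (b g) u i + lin_ext l (b g) v i)"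
    by (simp add: lin_ext_def distrib_right sum.distrib)
  then show ?case using Cons by simp
qed simp

lemma fold_lin_ext_scale:
  "fold (\<lambda>g. lin_ext l (b g)) ws (\<lambda>i. c * v i) = (\<lambda>i. c * fold (\<lambda>g. lin_ext l (b g)) ws v i)"
proof (induction ws arbitrary: v)
  case (Cons g ws)
  have "lin_ext l (b g) (\<lambda>i. c * v i) = (\<lambda>i. c * lin_ext l (b g) v i)"
    by (simp add: lin_ext_def sum_distrib_left mult.assoc)
  then show ?case using Cons by simp
qed simp

lemma free_act_vector_add:
  "free_act l b p (\<lambda>i. u i + v i) = (\<lambda>i. free_act l b p u i + free_act l b p v i)"
  by (simp add: free_act_def fold_lin_ext_add distrib_left sum.distrib)

lemma free_act_vector_scale: "free_act l b p (\<lambda>i. c * v i) = (\<lambda>i. c * free_act l b p v i)"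
  by (simp add: free_act_def fold_lin_ext_scale sum_distrib_left mult.left_commute)

lemma free_act_vector_0 [simp]: "free_act l b p (\<lambda>i. 0) = (\<lambda>i. 0)"
  using free_act_vector_scale[of l b p 0 "\<lambda>i. 0"] by simp

lemma free_act_vector_sum:
  "free_act l b p (\<lambda>i. \<Sum>k\<in>A. c k * u k i) = (\<lambda>i. \<Sum>k\<in>A. c k * free_act l b p (u k) i)"
  by (induction A rule: infinite_finite_induct)
    (simp_all add: free_act_vector_add free_act_vector_scale)

lemma free_act_mult: "free_act l b (p * r) v = free_act l b r (free_act l b p v)"
proof (induction p rule: free_alg_span_induct)
  case (word ws)
  show ?case
  proof (induction r rule: free_alg_span_induct)
    case (word us)
    have "fword ws * fword us = (fword (ws @ us) :: 'a free_alg)"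
      by (induction ws) (simp_all add: fword_Cons mult.assoc)
    then show ?case by (simp add: free_act_fword)
  qed (simp_all add: distrib_left free_act_add free_act_scale fconst_left_commute)
qed (simp_all add: distrib_right free_act_add free_act_scale mult.assoc
    free_act_vector_add free_act_vector_scale)

lemma free_act_fgen_bvec:
  assumes "k < l" shows "free_act l b (fgen g) (bvec c k) = (\<lambda>i. c * b g k i)"
proof -
  have "(\<Sum>j<l. (if j = k then c else 0) * b g j i) = c * b g k i" for i
    using assms by (simp add: if_distrib[of "\<lambda>c. c * _"] cong: if_cong)
  then show ?thesis by (simp add: free_act_fgen lin_ext_def bvec_def)
qed

lemma bvec_scale [simp]: "(\<lambda>i. c * bvec d k i) = bvec (c * d) k"
  by (auto simp: bvec_def)

lemma bvec_0 [simp]: "bvec 0 k = (\<lambda>i. 0)"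
  by (auto simp: bvec_def)

section \<open>Tables that satisfy the defining relations\<close>

locale A_table =
  fixes q \<alpha> :: "'k::field" and l :: nat and b :: "gen \<Rightarrow> nat \<Rightarrow> nat \<Rightarrow> 'k"
  assumes support: "k < l \<Longrightarrow> l \<le> i \<Longrightarrow> b g k i = 0"
    and relators: "r \<in> A_relators q \<alpha> \<Longrightarrow> k < l \<Longrightarrow> free_act l b r (bvec 1 k) = (\<lambda>i. 0)"
begin

definition V :: "(nat \<Rightarrow> 'k) set" where "V = {v. \<forall>i\<ge>l. v i = 0}"

lemma V_expand:
  assumes "v \<in> V" shows "v = (\<lambda>i. \<Sum>k<l. v k * bvec 1 k i)"
proof
  fix i
  have "(\<Sum>k<l. v k * bvec 1 k i) = (\<Sum>k<l. if k = i then v k else 0)"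
    by (intro sum.cong) (auto simp: bvec_def)
  then show "v i = (\<Sum>k<l. v k * bvec 1 k i)" using assms by (simp add: V_def)
qed

lemma bvec_mem_V: "k < l \<Longrightarrow> bvec c k \<in> V"
  by (simp add: V_def bvec_def)

lemma free_act_mem_V:
  assumes "v \<in> V" shows "free_act l b p v \<in> V"
proof (induction p rule: free_alg_span_induct)
  case (word ws)
  have "lin_ext l (b g) u \<in> V" for g u by (auto simp: V_def lin_ext_def support)
  then have "fold (\<lambda>g. lin_ext l (b g)) ws v \<in> V"
    using assms by (induction ws arbitrary: v) auto
  then show ?case by (simp add: free_act_fword)
qed (simp_all add: free_act_add free_act_scale V_def)

text \<open>The elements killing all of V form a two-sided ideal, because V is stable under the
  action; hence the relators on basis vectors decide.\<close>

lemma A_ideal_acts_zero: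
  assumes "p \<in> A_ideal q \<alpha>" "v \<in> V" shows "free_act l b p v = (\<lambda>i. 0)"
proof -
  have "free_act l b r v = (\<lambda>i. 0)" if r: "r \<in> A_relators q \<alpha>" and v: "v \<in> V" for r v
  proof -
    have "free_act l b r v = free_act l b r (\<lambda>i. \<Sum>k<l. v k * bvec 1 k i)"
      using V_expand[OF v] by simp
    also have "\<dots> = (\<lambda>i. 0)" unfolding free_act_vector_sum by (simp add: relators[OF r])
    finally show ?thesis .
  qed
  then have "A_ideal q \<alpha> \<subseteq> {p. \<forall>v\<in>V. free_act l b p v = (\<lambda>i. 0)}"
    by (intro A_ideal_minimal) (auto simp: free_act_add free_act_mult free_act_mem_V)
  then show ?thesis using assms by blast
qed

abbreviation M where "M \<equiv> basis_module l b"

lemma carrier_M [simp]: "carrier M = V"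
  and zero_M [simp]: "\<zero>\<^bsub>M\<^esub> = (\<lambda>i. 0)"
  and add_M [simp]: "u \<oplus>\<^bsub>M\<^esub> v = (\<lambda>i. u i + v i)"
  by (simp_all add: basis_module_def V_def)

text \<open>The representative picked by Hilbert choice differs from p by an element of the ideal,
  which acts as zero.\<close>

lemma act_A_class:
  assumes v: "v \<in> V" shows "A_class q \<alpha> p \<odot>\<^bsub>M\<^esub> v = free_act l b p v"
proof -
  let ?r = "SOME r. r \<in> A_class q \<alpha> p"
  have "?r \<in> A_class q \<alpha> p" using self_mem_A_class by (rule someI)
  then have "free_act l b (?r - p) v = (\<lambda>i. 0)"
    using v by (simp add: mem_A_class_iff A_ideal_acts_zero)
  then have "free_act l b ?r v = free_act l b p v"
    by (simp add: free_act_diff fun_eq_iff)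
  then show ?thesis by (simp add: basis_module_def)
qed

lemma right_module_M: "right_module (A_alg q \<alpha>) M"
proof (intro right_module.intro right_module_axioms.intro ring_A_alg)
  show "abelian_group M"
  proof (rule abelian_groupI)
    fix u assume "u \<in> carrier M"
    then show "\<exists>v\<in>carrier M. v \<oplus>\<^bsub>M\<^esub> u = \<zero>\<^bsub>M\<^esub>"
      by (intro bexI[of _ "\<lambda>i. - u i"]) (auto simp: V_def)
  qed (auto simp: V_def add_ac)
next
  have V_add: "(\<lambda>i. u i + v i) \<in> V" if "u \<in> V" "v \<in> V" for u v
    using that by (simp add: V_def)
  note simps = act_A_class free_act_mem_V free_act_add free_act_vector_add free_act_mult V_add
  show "a \<odot>\<^bsub>M\<^esub> v \<in> carrier M" if "a \<in> carrier (A_alg q \<alpha>)" "v \<in> carrier M" for a v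
    using that by (auto simp: carrier_A_alg simps)
  show "(a \<oplus>\<^bsub>A_alg q \<alpha>\<^esub> c) \<odot>\<^bsub>M\<^esub> v = a \<odot>\<^bsub>M\<^esub> v \<oplus>\<^bsub>M\<^esub> c \<odot>\<^bsub>M\<^esub> v"
    if "a \<in> carrier (A_alg q \<alpha>)" "c \<in> carrier (A_alg q \<alpha>)" "v \<in> carrier M" for a c v
    using that by (auto simp: carrier_A_alg simps simp flip: A_class_add)
  show "a \<odot>\<^bsub>M\<^esub> (u \<oplus>\<^bsub>M\<^esub> v) = a \<odot>\<^bsub>M\<^esub> u \<oplus>\<^bsub>M\<^esub> a \<odot>\<^bsub>M\<^esub> v"
    if "a \<in> carrier (A_alg q \<alpha>)" "u \<in> carrier M" "v \<in> carrier M" for a u v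
    using that by (auto simp: carrier_A_alg simps)
  show "(a \<otimes>\<^bsub>A_alg q \<alpha>\<^esub> c) \<odot>\<^bsub>M\<^esub> v = c \<odot>\<^bsub>M\<^esub> (a \<odot>\<^bsub>M\<^esub> v)"
    if "a \<in> carrier (A_alg q \<alpha>)" "c \<in> carrier (A_alg q \<alpha>)" "v \<in> carrier M" for a c v
    using that by (auto simp: carrier_A_alg simps simp flip: A_class_mult)
  show "\<one>\<^bsub>A_alg q \<alpha>\<^esub> \<odot>\<^bsub>M\<^esub> v = v" if "v \<in> carrier M" for v
    using that by (simp add: act_A_class flip: A_class_one)
qed

text \<open>A submodule is a sum of eigenspaces of the diagonal operator \<open>d\<close>, hence contains a basis
  vector.\<close>

lemma simple_M:
  assumes "0 < l"
    and d: "\<And>k. k < l \<Longrightarrow> free_act l b d (bvec 1 k) = bvec (e k) k" and e: "inj_on e {..<l}"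
    and reach: "\<And>k j. k < l \<Longrightarrow> j < l \<Longrightarrow> \<exists>p. free_act l b p (bvec 1 k) = bvec 1 j"
  shows "simple_right_module (A_alg q \<alpha>) M"
  unfolding simple_right_module_def
proof (intro conjI allI impI right_module_M)
  have "bvec 1 0 \<in> V" using \<open>0 < l\<close> by (rule bvec_mem_V)
  moreover have "bvec (1::'k) 0 \<noteq> (\<lambda>i. 0)" by (auto simp: bvec_def fun_eq_iff)
  ultimately show "carrier M \<noteq> {\<zero>\<^bsub>M\<^esub>}" by auto
next
  fix N assume N: "submodule N (A_alg q \<alpha>) M"
  interpret right_module "A_alg q \<alpha>" M by (rule right_module_M)
  have sub: "subgroup N (add_monoid M)" using N by (rule submodule.axioms(1))
  have NV: "N \<subseteq> V" using subgroup.subset[OF sub] by simp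
  have N0: "(\<lambda>i. 0) \<in> N" using subgroup.one_closed[OF sub] by simp
  have N_add: "(\<lambda>i. u i + v i) \<in> N" if "u \<in> N" "v \<in> N" for u v
    using subgroup.m_closed[OF sub that] by simp
  have N_act: "free_act l b p v \<in> N" if "v \<in> N" for p v
    using submodule.smult_closed[OF N A_class_mem[of q \<alpha> p] that] act_A_class[of v p] NV that
    by auto
  have N_scale: "(\<lambda>i. c * v i) \<in> N" if "v \<in> N" for c v
    using N_act[OF that, of "fconst c * 1"] by (simp only: free_act_scale free_act_1)
  have "N = carrier M" if nz: "N \<noteq> {\<zero>\<^bsub>M\<^esub>}"
  proof -
    obtain f where f: "f \<in> N" "f \<noteq> (\<lambda>i. 0)" using nz N0 by auto
    then obtain k where k: "f k \<noteq> 0" by auto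
    then have "k < l" using f(1) NV by (force simp: V_def not_less[symmetric])
    have d_act: "free_act l b d v i = e i * v i" if "v \<in> V" "i < l" for v i
    proof -
      have "free_act l b d v = free_act l b d (\<lambda>i. \<Sum>k<l. v k * bvec 1 k i)"
        using V_expand[OF that(1)] by simp
      also have "\<dots> = (\<lambda>i. \<Sum>k<l. v k * bvec (e k) k i)"
        unfolding free_act_vector_sum by (simp add: d)
      finally have "free_act l b d v i = (\<Sum>k<l. v k * bvec (e k) k i)" by simp
      also have "\<dots> = (\<Sum>k<l. if k = i then v k * e k else 0)"
        by (intro sum.cong) (auto simp: bvec_def)
      finally show ?thesis using that(2) by simp
    qed
    \<comment> \<open>Unnormalised Lagrange projection: applying d - e_j for each j in S. Taking S
      to be all indices except k leaves only the k-th coordinate of f.\<close>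
    have "\<exists>h\<in>N. \<forall>i<l. h i = (\<Prod>j\<in>S. e i - e j) * f i" if "finite S" for S
      using that
    proof (induction S rule: finite_induct)
      case empty then show ?case using f(1) by auto
    next
      case (insert j S)
      then obtain h where h: "h \<in> N" "\<forall>i<l. h i = (\<Prod>j\<in>S. e i - e j) * f i" by blast
      let ?h = "\<lambda>i. free_act l b d h i + - e j * h i"
      have hN: "?h \<in> N" using h(1) by (intro N_add N_act N_scale)
      have "?h i = (\<Prod>j\<in>insert j S. e i - e j) * f i" if "i < l" for i
      proof -
        have "?h i = (e i - e j) * h i"
          using d_act[OF subsetD[OF NV h(1)] that] by (simp add: left_diff_distrib)
        also have "\<dots> = (e i - e j) * ((\<Prod>j\<in>S. e i - e j) * f i)" using h(2) that by simp
        finally show ?thesis using insert.hyps by (simp add: mult.assoc)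
      qed
      then show ?case by (intro bexI[OF _ hN]) simp
    qed
    from this[of "{..<l} - {k}"]
    obtain h where h: "h \<in> N" "\<forall>i<l. h i = (\<Prod>j\<in>{..<l} - {k}. e i - e j) * f i" by auto
    define c where "c = h k"
    \<comment> \<open>The surviving factor is a product of differences of distinct
      eigenvalues.\<close>
    have "c \<noteq> 0"
      using h(2) \<open>k < l\<close> k e by (auto simp: c_def inj_on_def)
    have "h i = bvec c k i" for i
    proof -
      consider "i < l" "i \<noteq> k" | "i = k" | "l \<le> i" by linarith
      then show ?thesis
      proof cases
        case 1
        then have "(\<Prod>j\<in>{..<l} - {k}. e i - e j) = 0" by (intro prod_zero) auto
        then show ?thesis using 1 h(2) by (simp add: bvec_def)
      next
        case 2 then show ?thesis by (simp add: bvec_def c_def)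
      next
        case 3
        then have "h i = 0" using subsetD[OF NV h(1)] by (simp add: V_def)
        then show ?thesis using 3 \<open>k < l\<close> by (simp add: bvec_def)
      qed
    qed
    then have "h = bvec c k" by (rule ext)
    then have "bvec c k \<in> N" using h(1) by simp
    from N_scale[OF this, of "inverse c"] have "bvec 1 k \<in> N" using \<open>c \<noteq> 0\<close> by simp
    then have basis: "bvec 1 j \<in> N" if j: "j < l" for j
    proof -
      obtain p where "free_act l b p (bvec 1 k) = bvec 1 j" using reach[OF \<open>k < l\<close> j] by blast
      then show ?thesis using N_act[OF \<open>bvec 1 k \<in> N\<close>, of p] by simp
    qed
    have "v \<in> N" if "v \<in> V" for v
    proof -
      have "(\<lambda>i. \<Sum>k\<in>S. v k * bvec 1 k i) \<in> N" if "S \<subseteq> {..<l}" for S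
        using finite_subset[OF that finite_lessThan] that
        by (induction S rule: finite_induct) (auto intro!: N0 N_add N_scale basis simp del: bvec_scale)
      from this[OF order_refl] show ?thesis by (subst V_expand[OF \<open>v \<in> V\<close>])
    qed
    then show ?thesis using NV by auto
  qed
  then show "N = {\<zero>\<^bsub>M\<^esub>} \<or> N = carrier M" by blast
qed

end

section \<open>Simplicity and classification\<close>

lemma primitive_root_inj_on_powers:
  assumes "is_primitive_root_of_unity l (t :: 'k::field)"
  shows "inj_on (\<lambda>k. t ^ k) {..<l}"
proof -
  have *: "t ^ l = 1" "0 < l" "\<And>k. 0 < k \<Longrightarrow> k < l \<Longrightarrow> t ^ k \<noteq> 1"
    using assms by (auto simp: is_primitive_root_of_unity_def)
  then have "t \<noteq> 0" by (auto simp: power_0_left)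
  have False if "i < j" "j < l" "t ^ i = t ^ j" for i j
  proof -
    have "t ^ i * t ^ (j - i) = t ^ (i + (j - i))" by (simp only: power_add)
    then have "t ^ i * t ^ (j - i) = t ^ i * 1" using that by simp
    then have "t ^ (j - i) = 1" using \<open>t \<noteq> 0\<close> by simp
    then show False using *(3)[of "j - i"] that by simp
  qed
  then show ?thesis by (metis inj_onI lessThan_iff linorder_neqE_nat)
qed

lemma free_act_relator_xy:
  assumes xy: "free_act l b (fgen GX * fgen GY) v = (\<lambda>i. c * v i)"
    and yx: "free_act l b (fgen GY * fgen GX) v = (\<lambda>i. d * v i)"
    and "c = t * d + \<alpha>"
  shows "free_act l b (fgen GX * fgen GY - (fconst t * fgen GY * fgen GX + fconst \<alpha>)) v = (\<lambda>i. 0)"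
proof -
  have "fconst t * fgen GY * fgen GX + fconst \<alpha>
      = fconst t * (fgen GY * fgen GX) + fconst \<alpha> * (1 :: 'a free_alg)"
    by (simp add: mult.assoc)
  then show ?thesis
    by (simp only: free_act_diff free_act_add free_act_scale xy yx free_act_1)
      (simp add: assms(3) algebra_simps)
qed

text \<open>In both families x y and y x act diagonally, so the first relation reduces to a scalar
  identity for each k; the other two relators contain z in every term.\<close>

lemma A_tableI:
  assumes support: "\<And>g k i. k < l \<Longrightarrow> l \<le> i \<Longrightarrow> b g k i = 0"
    and z: "\<And>k. b GZ k = (\<lambda>i. 0)"
    and xy: "\<And>k. k < l \<Longrightarrow> free_act l b (fgen GX * fgen GY) (bvec 1 k) = bvec (c k) k"
    and yx: "\<And>k. k < l \<Longrightarrow> free_act l b (fgen GY * fgen GX) (bvec 1 k) = bvec (d k) k"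
    and cd: "\<And>k. k < l \<Longrightarrow> c k = q ^ 2 * d k + \<alpha>"
  shows "A_table q \<alpha> l b"
proof
  fix r k assume r: "r \<in> A_relators q \<alpha>" and k: "k < l"
  have z_act: "free_act l b (fgen GZ) v = (\<lambda>i. 0)" for v
    by (simp add: free_act_fgen lin_ext_def z)
  have "free_act l b (fgen GX * fgen GY) (bvec 1 k) = (\<lambda>i. c k * bvec 1 k i)"
    "free_act l b (fgen GY * fgen GX) (bvec 1 k) = (\<lambda>i. d k * bvec 1 k i)"
    using xy[OF k] yx[OF k] by simp_all
  from free_act_relator_xy[OF this cd[OF k]] show "free_act l b r (bvec 1 k) = (\<lambda>i. 0)"
    using r by (auto simp: A_relators_def free_act_diff free_act_mult free_act_scale z_act mult.assoc)
qed (rule support)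

lemma free_act_commutator:
  assumes "free_act l b (p * r) v = bvec c k" "free_act l b (r * p) v = bvec d k"
  shows "free_act l b (p * r - r * p) v = bvec (c - d) k"
  by (auto simp: free_act_diff assms bvec_def)

lemma reach_iterate:
  assumes step: "\<And>k. P k \<Longrightarrow> \<exists>p. free_act l b p (bvec 1 k) = bvec 1 (\<sigma> k)"
    and closed: "\<And>k. P k \<Longrightarrow> P (\<sigma> k)" and "P k"
  shows "\<exists>p. free_act l b p (bvec 1 k) = bvec 1 ((\<sigma> ^^ n) k)"
proof -
  have "P ((\<sigma> ^^ n) k) \<and> (\<exists>p. free_act l b p (bvec 1 k) = bvec 1 ((\<sigma> ^^ n) k))"
  proof (induction n)
    case 0
    show ?case using \<open>P k\<close> by (auto intro: exI[of _ 1])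
  next
    case (Suc n)
    then obtain p r where "free_act l b p (bvec 1 k) = bvec 1 ((\<sigma> ^^ n) k)"
      "free_act l b r (bvec 1 ((\<sigma> ^^ n) k)) = bvec 1 ((\<sigma> ^^ Suc n) k)"
      using step by fastforce
    then have "free_act l b (p * r) (bvec 1 k) = bvec 1 ((\<sigma> ^^ Suc n) k)"
      by (simp add: free_act_mult)
    then show ?case using Suc closed by auto
  qed
  then show ?thesis by blast
qed

lemma reach_of_generator:
  assumes "k < l" "b g k = bvec c j" "c \<noteq> 0"
  shows "\<exists>p. free_act l b p (bvec 1 k) = bvec 1 j"
proof
  show "free_act l b (fconst (inverse c) * fgen g) (bvec 1 k) = bvec 1 j"
    using assms by (simp add: free_act_scale free_act_fgen_bvec)
qed

lemma M6_simple:
  fixes q \<alpha> :: "'k::field"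
  assumes q: "is_primitive_root_of_unity l (q ^ 2)" and l: "l > 1"
    and \<mu>: "\<mu> \<noteq> 0" "\<nu> \<noteq> 0"
  shows "A_table q \<alpha> l (M6_basis_act q \<alpha> l \<mu> \<nu>)"
    and "simple_right_module (A_alg q \<alpha>) (M6 q \<alpha> l \<mu> \<nu>)"
proof -
  let ?b = "M6_basis_act q \<alpha> l \<mu> \<nu>"
  define t where "t = q ^ 2"
  have t_l: "t ^ l = 1" using q by (simp add: t_def is_primitive_root_of_unity_def)
  have "t ^ 1 \<noteq> 1" using q l unfolding is_primitive_root_of_unity_def t_def by blast
  then have t_1: "t - 1 \<noteq> 0" by simp
  have q_pow: "q ^ (2 * k) = t ^ k" for k by (simp add: t_def power_mult)
  define s where "s k = (if k = l - 1 then 0 else Suc k)" for k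
  \<comment> \<open>The eigenvalue of y x on m_k, with k allowed to range over all naturals. It is
    l-periodic, so the wrap-around of the table agrees with the general formula, and x y has
    eigenvalue \<open>y (Suc k)\<close>.\<close>
  define y where "y k = (t ^ k * \<nu> - \<alpha>) / (t - 1)" for k
  have s_less: "s k < l" if "k < l" for k using that l by (auto simp: s_def)
  have x: "?b GX k = bvec \<mu> (s k)" for k by (simp add: M6_basis_act_def s_def)
  have y_s: "?b GY (s k) = bvec (inverse \<mu> * y (Suc k)) k" if "k < l" for k
  proof (cases "k = l - 1")
    case True
    then have "Suc k = l" using l by simp
    then have "t ^ Suc k = 1" using t_l by simp
    then show ?thesis using True by (simp add: s_def M6_basis_act_def y_def t_def)
  next
    case False
    then have "s k = Suc k" by (simp add: s_def)
    moreover have "?b GY (Suc k) = bvec (inverse \<mu> * ((q ^ (2 * Suc k) * \<nu> - \<alpha>) / (q ^ 2 - 1))) k"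
      by (simp add: M6_basis_act_def)
    ultimately show ?thesis by (simp only: q_pow y_def t_def[symmetric])
  qed
  have xy: "free_act l ?b (fgen GX * fgen GY) (bvec 1 k) = bvec (y (Suc k)) k" if "k < l" for k
    using that \<mu> by (simp add: free_act_mult free_act_fgen_bvec x y_s s_less flip: mult.assoc)
  have yx: "free_act l ?b (fgen GY * fgen GX) (bvec 1 k) = bvec (y k) k" if "k < l" for k
  proof -
    \<comment> \<open>The predecessor of k under the cyclic shift s.\<close>
    define j where "j = (if k = 0 then l - 1 else k - 1)"
    have j: "j < l" "s j = k" using that l by (auto simp: j_def s_def)
    have "Suc j = (if k = 0 then l else k)" using l by (simp add: j_def)
    then have "t ^ Suc j = t ^ k" using t_l by simp
    then have "y (Suc j) = y k" by (simp add: y_def)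
    then have "free_act l ?b (fgen GY * fgen GX) (bvec 1 k) = bvec (inverse \<mu> * y k * \<mu>) k"
      using y_s[OF j(1)] that j by (simp add: free_act_mult free_act_fgen_bvec x)
    also have "inverse \<mu> * y k * \<mu> = y k" using \<mu> by (simp add: field_simps)
    finally show ?thesis .
  qed
  show table: "A_table q \<alpha> l ?b"
  proof (rule A_tableI[OF _ _ xy yx])
    show "?b g k i = 0" if "k < l" "l \<le> i" for g k i
      using that l by (auto simp: M6_basis_act_def bvec_def split: gen.split)
    show "?b GZ k = (\<lambda>i. 0)" for k by (simp add: M6_basis_act_def)
    show "y (Suc k) = q ^ 2 * y k + \<alpha>" for k
      using t_1 by (simp add: y_def field_simps flip: t_def)
  qed
  interpret A_table q \<alpha> l ?b by (rule table)
  show "simple_right_module (A_alg q \<alpha>) (M6 q \<alpha> l \<mu> \<nu>)"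
    unfolding M6_def
  proof (rule simple_M[of "fgen GX * fgen GY - fgen GY * fgen GX" "\<lambda>k. y (Suc k) - y k"])
    show "free_act l ?b (fgen GX * fgen GY - fgen GY * fgen GX) (bvec 1 k)
        = bvec (y (Suc k) - y k) k" if "k < l" for k
      using that by (intro free_act_commutator xy yx)
    \<comment> \<open>The eigenvalue of g on m_k; these are distinct for k < l since t is a
      primitive l-th root of unity and \<nu> is nonzero.\<close>
    have "y (Suc k) - y k = t ^ k * \<nu>" for k
    proof -
      have "y (Suc k) - y k = t ^ k * \<nu> * (t - 1) / (t - 1)"
        by (simp add: y_def algebra_simps flip: diff_divide_distrib)
      then show ?thesis using t_1 by simp
    qed
    then show "inj_on (\<lambda>k. y (Suc k) - y k) {..<l}"
      using primitive_root_inj_on_powers[OF q] \<mu> by (simp add: inj_on_def t_def)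
    show "\<exists>p. free_act l ?b p (bvec 1 k) = bvec 1 j" if "k < l" "j < l" for k j
    proof -
      \<comment> \<open>Since x only shifts forwards, j is reached from k after l - k + j
        steps.\<close>
      have "(s ^^ n) k = (k + n) mod l" for n
        using that l by (induction n) (auto simp: s_def mod_Suc)
      from this[of "l - k + j"] have "(s ^^ (l - k + j)) k = j" using that by simp
      moreover have step: "\<exists>p. free_act l ?b p (bvec 1 k) = bvec 1 (s k)" if "k < l" for k
        using reach_of_generator[where b = ?b and g = GX, OF that x \<mu>(1)] .
      ultimately show ?thesis
        using reach_iterate[where P = "\<lambda>k. k < l", OF step s_less \<open>k < l\<close>, of "l - k + j"]
        by simp
    qed
  qed (use l in simp)
qed

lemma M7_simple:
  fixes q \<alpha> :: "'k::field"
  assumes q: "is_primitive_root_of_unity l (q ^ 2)" and l: "l > 1" and \<alpha>: "\<alpha> \<noteq> 0"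
  shows "A_table q \<alpha> l (M7_basis_act q \<alpha> l \<mu>)"
    and "simple_right_module (A_alg q \<alpha>) (M7 q \<alpha> l \<mu>)"
proof -
  let ?b = "M7_basis_act q \<alpha> l \<mu>"
  define t where "t = q ^ 2"
  have t_l: "t ^ l = 1" using q by (simp add: t_def is_primitive_root_of_unity_def)
  then have t_0: "t \<noteq> 0" using l by (auto simp: power_0_left)
  have t_ne: "t ^ k \<noteq> 1" if "0 < k" "k < l" for k
    using q that unfolding is_primitive_root_of_unity_def t_def by blast
  from t_ne[of 1] have t_1: "t \<noteq> 1" using l by simp
  have q_pow: "q ^ (2 * k) = t ^ k" for k by (simp add: t_def power_mult)
  define x where "x k = - (inverse t * \<alpha> * ((1 - inverse (t ^ k)) / (1 - inverse t)))" for k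
  have x_eq: "x k = \<alpha> * (inverse (t ^ k) - 1) / (t - 1)" for k
  proof -
    have "inverse t / (1 - inverse t) = 1 / (t - 1)" using t_0 t_1 by (simp add: field_simps)
    moreover have "x k = \<alpha> * (inverse (t ^ k) - 1) * (inverse t / (1 - inverse t))"
      by (simp add: x_def divide_inverse algebra_simps)
    ultimately show ?thesis by simp
  qed
  \<comment> \<open>The two zeros cover the ends of the chain: x kills m_0, and y x kills m_(l-1)
    because y sends it to a multiple of m_0. With them x y and y x have eigenvalues
    \<open>x k\<close> and \<open>x (Suc k)\<close> for every k < l.\<close>
  have x_0: "x 0 = 0" and x_l: "x l = 0" by (simp_all add: x_def t_l)
  have x_nz: "x k \<noteq> 0" if "0 < k" "k < l" for k
    using t_ne[OF that] t_0 t_1 \<alpha> by (simp add: x_def)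
  have X: "?b GX k = bvec (x k) (k - 1)" for k
  proof (cases "k = 0")
    case False
    then show ?thesis by (simp add: M7_basis_act_def x_def q_pow flip: t_def)
  qed (simp add: M7_basis_act_def x_0)
  have Y: "?b GY k = bvec 1 (Suc k)" if "Suc k < l" for k
    using that by (auto simp: M7_basis_act_def)
  have xy: "free_act l ?b (fgen GX * fgen GY) (bvec 1 k) = bvec (x k) k" if "k < l" for k
  proof (cases k)
    case 0
    then show ?thesis using that by (simp add: free_act_mult free_act_fgen_bvec X x_0)
  next
    case (Suc j)
    then show ?thesis using that by (simp add: free_act_mult free_act_fgen_bvec X Y)
  qed
  have yx: "free_act l ?b (fgen GY * fgen GX) (bvec 1 k) = bvec (x (Suc k)) k" if "k < l" for k
  proof (cases "Suc k = l")
    case True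
    then have "?b GY k = bvec \<mu> 0" by (auto simp: M7_basis_act_def)
    then show ?thesis using that l True by (simp add: free_act_mult free_act_fgen_bvec X x_0 x_l)
  next
    case False
    then show ?thesis using that by (simp add: free_act_mult free_act_fgen_bvec X Y)
  qed
  show table: "A_table q \<alpha> l ?b"
  proof (rule A_tableI[OF _ _ xy yx])
    show "?b g k i = 0" if "k < l" "l \<le> i" for g k i
      using that l by (auto simp: M7_basis_act_def bvec_def split: gen.split)
    show "?b GZ k = (\<lambda>i. 0)" for k by (simp add: M7_basis_act_def)
    show "x k = q ^ 2 * x (Suc k) + \<alpha>" for k
    proof -
      have "t * inverse (t ^ Suc k) = inverse (t ^ k)" using t_0 by simp
      then have "t * x (Suc k) = \<alpha> * (inverse (t ^ k) - t) / (t - 1)"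
        by (simp add: x_eq right_diff_distrib mult.left_commute[of t] del: power_Suc)
      then show ?thesis using t_1 by (simp add: x_eq field_simps flip: t_def)
    qed
  qed
  interpret A_table q \<alpha> l ?b by (rule table)
  show "simple_right_module (A_alg q \<alpha>) (M7 q \<alpha> l \<mu>)"
    unfolding M7_def
  proof (rule simple_M[of "fgen GX * fgen GY - fgen GY * fgen GX" "\<lambda>k. x k - x (Suc k)"])
    show "free_act l ?b (fgen GX * fgen GY - fgen GY * fgen GX) (bvec 1 k)
        = bvec (x k - x (Suc k)) k" if "k < l" for k
      using that by (intro free_act_commutator xy yx)
    \<comment> \<open>The g-eigenvalues, again a nonzero constant times distinct powers of
      t.\<close>
    have "x k - x (Suc k) = inverse t * \<alpha> * inverse (t ^ k)" for k
    proof -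
      have "x k - x (Suc k) = \<alpha> * (inverse (t ^ k) - inverse (t ^ Suc k)) / (t - 1)"
        by (simp add: x_eq right_diff_distrib diff_divide_distrib del: power_Suc)
      also have "inverse (t ^ k) - inverse (t ^ Suc k) = inverse t * inverse (t ^ k) * (t - 1)"
        using t_0 by (simp add: algebra_simps)
      finally show ?thesis using t_1 by simp
    qed
    then show "inj_on (\<lambda>k. x k - x (Suc k)) {..<l}"
      using primitive_root_inj_on_powers[OF q] \<alpha> t_0 by (simp add: inj_on_def t_def)
    show "\<exists>p. free_act l ?b p (bvec 1 k) = bvec 1 j" if "k < l" "j < l" for k j
    proof -
      \<comment> \<open>As \<mu> may be 0, the step from m_(l-1) to m_0 by y cannot be relied on.
        The path goes down to m_0 by x, whose coefficients are nonzero strictly between 0 and l, and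
        then up by y.\<close>
      have down: "\<exists>p. free_act l ?b p (bvec 1 k) = bvec 1 (0::nat)" if "k < l" for k
        using that
      proof (induction k)
        case 0 then show ?case by (auto intro: exI[of _ 1])
      next
        case (Suc k)
        then obtain p where "free_act l ?b p (bvec 1 k) = bvec 1 0" by auto
        moreover have "?b GX (Suc k) = bvec (x (Suc k)) k" using X[of "Suc k"] by simp
        then obtain r where "free_act l ?b r (bvec 1 (Suc k)) = bvec 1 k"
          using reach_of_generator[OF Suc.prems] x_nz Suc.prems by blast
        ultimately have "free_act l ?b (r * p) (bvec 1 (Suc k)) = bvec 1 0"
          by (simp add: free_act_mult)
        then show ?case by blast
      qed
      have up: "\<exists>p. free_act l ?b p (bvec 1 0) = bvec 1 k" if "k < l" for k
        using that
      proof (induction k)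
        case 0 then show ?case by (auto intro: exI[of _ 1])
      next
        case (Suc k)
        then obtain p where "free_act l ?b p (bvec 1 0) = bvec 1 k" by auto
        moreover have "free_act l ?b (fgen GY) (bvec 1 k) = bvec 1 (Suc k)"
          using Suc.prems by (simp add: free_act_fgen_bvec Y)
        ultimately have "free_act l ?b (p * fgen GY) (bvec 1 0) = bvec 1 (Suc k)"
          by (simp add: free_act_mult)
        then show ?case by blast
      qed
      from down[OF \<open>k < l\<close>] up[OF \<open>j < l\<close>] show ?thesis by (metis free_act_mult)
    qed
  qed (use l in simp)
qed

text \<open>Compares the nonzero vector v s of M with m_0; the hypothesis on p is the inclusion of
  their annihilators.\<close>

lemma basis_module_iso:
  fixes M :: "('k::field free_alg set, 'm) module"
  assumes "A_table q \<alpha> l b" and N: "simple_right_module (A_alg q \<alpha>) (basis_module l b)"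
    and M: "simple_right_module (A_alg q \<alpha>) M" and v: "v \<in> carrier M" and "0 < l"
    and s: "A_class q \<alpha> s \<odot>\<^bsub>M\<^esub> v \<noteq> \<zero>\<^bsub>M\<^esub>"
    and ann: "\<And>p. free_act l b p (bvec 1 0) = (\<lambda>i. 0) \<Longrightarrow> A_class q \<alpha> (s * p) \<odot>\<^bsub>M\<^esub> v = \<zero>\<^bsub>M\<^esub>"
  shows "right_module_iso (A_alg q \<alpha>) M (basis_module l b)"
proof -
  interpret N: A_table q \<alpha> l b by fact
  interpret right_module "A_alg q \<alpha>" M using M by (simp add: simple_right_module_def)
  have w: "bvec 1 0 \<in> N.V" using \<open>0 < l\<close> by (rule N.bvec_mem_V)
  show ?thesis
  proof (rule simple_right_module_iso_of_annihilator[OF M N act_closed[OF A_class_mem v] s])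
    show "bvec 1 0 \<in> carrier (basis_module l b)" using w by simp
    show "bvec 1 0 \<noteq> \<zero>\<^bsub>basis_module l b\<^esub>" by (auto simp: bvec_def fun_eq_iff)
    fix a assume "a \<in> carrier (A_alg q \<alpha>)"
      and a: "a \<odot>\<^bsub>basis_module l b\<^esub> bvec 1 0 = \<zero>\<^bsub>basis_module l b\<^esub>"
    then obtain p where p: "a = A_class q \<alpha> p" by (auto simp: carrier_A_alg)
    then have "A_class q \<alpha> (s * p) \<odot>\<^bsub>M\<^esub> v = \<zero>\<^bsub>M\<^esub>"
      using a w by (intro ann) (simp add: N.act_A_class)
    then show "a \<odot>\<^bsub>M\<^esub> (A_class q \<alpha> s \<odot>\<^bsub>M\<^esub> v) = \<zero>\<^bsub>M\<^esub>"
      using v by (simp add: p A_class_mult act_mult)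
  qed
qed

theorem theorem8p6:
  fixes q \<alpha> :: "'k::alg_closed_field" and l :: nat
  assumes "q \<noteq> 0" and "\<alpha> \<noteq> 0" and "l > 1"
    and "is_primitive_root_of_unity l (q^2)"
  shows "(\<forall>\<mu>\<^sub>1 \<mu>\<^sub>2. \<mu>\<^sub>1 \<noteq> 0 \<and> \<mu>\<^sub>2 \<noteq> 0 \<longrightarrow>
            simple_right_module (A_alg q \<alpha>) (M6 q \<alpha> l \<mu>\<^sub>1 \<mu>\<^sub>2)) \<and>
         (\<forall>\<mu>. simple_right_module (A_alg q \<alpha>) (M7 q \<alpha> l \<mu>)) \<and>
         (\<forall>M :: ('k free_alg set, 'm) module.
            simple_right_module (A_alg q \<alpha>) M \<and>
            acts_nilpotently M (A_gen q \<alpha> GZ) \<and>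
            acts_invertibly M (A_g q \<alpha>) \<longrightarrow>
            (\<exists>\<mu>\<^sub>1 \<mu>\<^sub>2. \<mu>\<^sub>1 \<noteq> 0 \<and> \<mu>\<^sub>2 \<noteq> 0 \<and>
               right_module_iso (A_alg q \<alpha>) M (M6 q \<alpha> l \<mu>\<^sub>1 \<mu>\<^sub>2)) \<or>
            (\<exists>\<mu>. right_module_iso (A_alg q \<alpha>) M (M7 q \<alpha> l \<mu>)))"
proof (intro conjI allI impI)
  note q = \<open>is_primitive_root_of_unity l (q^2)\<close> \<open>l > 1\<close>
  show "simple_right_module (A_alg q \<alpha>) (M6 q \<alpha> l \<mu>\<^sub>1 \<mu>\<^sub>2)" if "\<mu>\<^sub>1 \<noteq> 0 \<and> \<mu>\<^sub>2 \<noteq> 0" for \<mu>\<^sub>1 \<mu>\<^sub>2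
    using M6_simple(2)[OF q] that by blast
  show "simple_right_module (A_alg q \<alpha>) (M7 q \<alpha> l \<mu>)" for \<mu>
    using M7_simple(2)[OF q \<open>\<alpha> \<noteq> 0\<close>] .
  fix M :: "('k free_alg set, 'm) module"
  assume "simple_right_module (A_alg q \<alpha>) M \<and> acts_nilpotently M (A_gen q \<alpha> GZ) \<and>
    acts_invertibly M (A_g q \<alpha>)"
  then have M: "simple_right_module (A_alg q \<alpha>) M" and z: "acts_nilpotently M (A_gen q \<alpha> GZ)"
    and g: "acts_invertibly M (A_g q \<alpha>)" by auto
  interpret right_module "A_alg q \<alpha>" M using M by (simp add: simple_right_module_def)
  obtain v where v: "v \<in> carrier M" "v \<noteq> \<zero>\<^bsub>M\<^esub>"
    using M M.zero_closed unfolding simple_right_module_def by blast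
  interpret quantum_right_ideal "{p. A_class q \<alpha> p \<odot>\<^bsub>M\<^esub> v = \<zero>\<^bsub>M\<^esub>}" "q ^ 2" \<alpha> l
    by (rule annihilator_quantum_right_ideal[OF q M z g v])
  have "l > 0" using \<open>l > 1\<close> by simp
  note iso = basis_module_iso[OF _ _ M v(1) this]
  from M6_or_M7_vector[OF refl] show "(\<exists>\<mu>\<^sub>1 \<mu>\<^sub>2. \<mu>\<^sub>1 \<noteq> 0 \<and> \<mu>\<^sub>2 \<noteq> 0 \<and>
      right_module_iso (A_alg q \<alpha>) M (M6 q \<alpha> l \<mu>\<^sub>1 \<mu>\<^sub>2)) \<or>
    (\<exists>\<mu>. right_module_iso (A_alg q \<alpha>) M (M7 q \<alpha> l \<mu>))"
  proof (elim disjE exE conjE, goal_cases)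
    case (1 \<mu>\<^sub>1 \<mu>\<^sub>2 s)
    then have "right_module_iso (A_alg q \<alpha>) M (M6 q \<alpha> l \<mu>\<^sub>1 \<mu>\<^sub>2)"
      unfolding M6_def
      by (intro iso[where s = s] M6_simple[OF q, unfolded M6_def]) auto
    with 1 show ?case by blast
  next
    case (2 \<mu> s)
    then have "right_module_iso (A_alg q \<alpha>) M (M7 q \<alpha> l \<mu>)"
      unfolding M7_def
      by (intro iso[where s = s] M7_simple[OF q \<open>\<alpha> \<noteq> 0\<close>, unfolded M7_def]) auto
    then show ?case by blast
  qed
qed

end
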